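(* Suppose that for any $x^{0}\in\mathrm{dom}F^{A}$ the level set $\mathcal{L}_{F^{A}}(x^0):=\{x:F^{A}(x)\preceq F^{A}(x^0)\}$ is compact, and that $f_{i}$ is $L_{i}$-smooth for each $i\in[m]$. Let $\{x^{k}\}$ be the sequence of points generated by the inexact subspace preconditioned proximal Barzilai--Borwein method (described in the context). Then $\{x^k\}$ has at least one accumulation point, and any accumulation point $x^*$ is a Pareto critical point of $F^A$.
   Context: Problem: minimize $F^A(x)=(F_1^A(x),\dots,F_m^A(x))$, $F_i^A(x)=f_i(x)+g_i(Ax)$, over $x\in\mathbb{R}^n$, where $A\in\mathbb{R}^{p\times n}$, $f_i:\mathbb{R}^n\to\mathbb{R}$ is continuously differentiable and $g_i:\mathbb{R}^p\to\mathbb{R}\cup\{+\infty\}$ is proper, convex, lower semicontinuous. $\mathrm{dom}F^A=\{x:Ax\in\bigcap_i\mathrm{dom}(g_i)\}$. $[m]=\{1,\dots,m\}$, $\Delta_m$ is the unit simplex in $\mathbb{R}^m$; $u\preceq v$ is the componentwise order for vectors and the Loewner order for symmetric matrices. $f_i$ is $L_i$-smooth if $f_i(y)\le f_i(x)+\langle\nabla f_i(x),y-x\rangle+\frac{L_i}{2}\|y-x\|^2$ for all $x,y$. A point $x^*$ is Pareto critical if $\max_{i\in[m]}(F_i^A)'(x^*;d)\ge0$ for all $d\in\mathbb{R}^n$ (directional derivatives). For $w\in\mathbb{R}^m_+$: $f_w=\sum w_if_i$, $g_w=\sum w_ig_i$ (equal to $+\infty$ where some $g_i$ is), $\nabla f_w=\sum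 w_i\nabla f_i$; $\lambda/\alpha$ is componentwise division; $\|x\|_P=\sqrt{\langle x,Px\rangle}$; $Jf$ is the Jacobian of $f=(f_1,\dots,f_m)$, $g=(g_1,\dots,g_m)$. Algorithm. Inputs: $x^0\in\mathrm{dom}F^A$, $\epsilon,\delta\in[0,1)$, $0<c_1\le c_2$, $0<c_3\le c_4$, $\sigma,\gamma\in(0,1)$, $0<\alpha_{\min}\le\alpha_{\max}$. Write $s_{k-1}=x^k-x^{k-1}$, $y_i^{k-1}=\nabla f_i(x^k)-\nabla f_i(x^{k-1})$ (with an auxiliary $x^{-1}$ near $x^0$ for $k=0$). For $k=0,1,2,\dots$: 1. Choose a symmetric $P_k$ with $c_3I_n\preceq P_k\preceq c_4I_n$. For $i\in[m]$ let $\tilde\alpha_i^k=\max\{\alpha_{\min},\min\{\tau,\alpha_{\max}\}\}$ with $\tau=\langle s_{k-1},y_i^{k-1}\rangle/\|s_{k-1}\|_{P_k}^2$ if $\langle s_{k-1},y_i^{k-1}\rangle>0$, $\tau=\|y_i^{k-1}\|/\|P_ks_{k-1}\|$ if $\langle s_{k-1},y_i^{k-1}\rangle<0$; and $\tilde\alpha_i^k=\alpha_{\min}$ if $\langle s_{k-1},y_i^{k-1}\rangle=0$. 2. For $\lambda\in\Delta_m$ let $x(\lambda)$ be the minimizer over $x$ of $\langle\nabla f_{\lambda/\tilde\alpha^k}(x^k),x-x^k\rangle+g_{\lambda/\tilde\alpha^k}(Ax)-g_{\lambda/\tilde\alpha^k}(Ax^k)+\frac12\|x-x^k\|_{P_k}^2$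 and let $\mathcal{D}^k_{PBB}(\lambda)=\max_{i}\frac{\langle\nabla f_i(x^k),x(\lambda)-x^k\rangle+g_i(Ax(\lambda))-g_i(Ax^k)}{\tilde\alpha_i^k}$. Compute $\lambda^{k,\epsilon}_{PBB}\in\Delta_m$ such that, with $v_{k,\epsilon}:=x(\lambda^{k,\epsilon}_{PBB})-x^k$ and $w=\lambda^{k,\epsilon}_{PBB}/\tilde\alpha^k$, $$\mathcal{D}^k_{PBB}(\lambda^{k,\epsilon}_{PBB})\le(1-\epsilon)\left(\langle\nabla f_w(x^k),v_{k,\epsilon}\rangle+g_w(Ax^k+Av_{k,\epsilon})-g_w(Ax^k)\right).$$ If $v_{k,\epsilon}=0$, stop and return $x^k$. 3. If $k=0$: set $d_0=v_{0,\epsilon}$, $\lambda^{0,\epsilon,\delta}=\lambda^{0,\epsilon}_{PBB}$, $\alpha^0=\tilde\alpha^0$, and go to step 5. 4. If $k\ge1$: let $u_k$ be the $\|\cdot\|_{P_k}$-projection of $x^k+s_{k-1}$ onto $\bigcap_i\mathrm{dom}(g_i\circ A)$, minus $x^k$. For a vector $v$ let $B_k(v)=\frac1{\epsilon_k}\left(\nabla f_{\lambda^{k-1,\epsilon,\delta}/\alpha^{k-1}}(x^k+\epsilon_kv)-\nabla f_{\lambda^{k-1,\epsilon,\delta}/\alpha^{k-1}}(x^k)\right)$ with $\epsilon_k>0$, and let $q_k(v)=\max\{c_1,\min\{\rho,c_2\}\}$ with $\rho=\langle v,B_k(v)\rangle/\|v\|^2$ if $\langle v,B_k(v)\rangle>0$,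 $\rho=\|B_k(v)\|/\|v\|$ if $\langle v,B_k(v)\rangle<0$, and $q_k(v)=c_1$ if $\langle v,B_k(v)\rangle=0$. Set $\tilde u_{k,\epsilon}=u_k-\frac{\langle u_k,B_k(v_{k,\epsilon})\rangle}{q_k(v_{k,\epsilon})\|v_{k,\epsilon}\|^2}v_{k,\epsilon}$. Let $\alpha_i^k=\max\{\alpha_{\min},\min\{\tau,\alpha_{\max}\}\}$ with $\tau=\frac{\langle s_{k-1},y_i^{k-1}\rangle}{q_k(s_{k-1})\|s_{k-1}\|^2}$ if $\langle s_{k-1},y_i^{k-1}\rangle>0$, $\tau=\frac{\|y_i^{k-1}\|}{q_k(s_{k-1})\|s_{k-1}\|}$ if $\langle s_{k-1},y_i^{k-1}\rangle<0$, and $\alpha_i^k=\alpha_{\min}$ if $\langle s_{k-1},y_i^{k-1}\rangle=0$. For $\lambda\in\Delta_m$ let $z_1(\lambda),z_2(\lambda)\in\mathbb{R}$ be minimizers of $z_1\mapsto\langle\frac{\lambda}{\alpha^k},z_1Jf(x^k)v_{k,\epsilon}+g(Ax^k+z_1Av_{k,\epsilon})\rangle+\frac{q_k(v_{k,\epsilon})}2\|v_{k,\epsilon}\|^2z_1^2$ and $z_2\mapsto\langle\frac{\lambda}{\alpha^k},z_2Jf(x^k)\tilde u_{k,\epsilon}+g(Ax^k+z_2A\tilde u_{k,\epsilon})\rangle+\frac{q_k(\tilde u_{k,\epsilon})}2\|\tilde u_{k,\epsilon}\|^2z_2^2$, and let $$\mathcal{D}^k(\lambda)=\max_i\frac{\langle\nabla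 f_i(x^k),z_1(\lambda)v_{k,\epsilon}+z_2(\lambda)\tilde u_{k,\epsilon}\rangle+g_i(Ax^k+z_1(\lambda)Av_{k,\epsilon})+g_i(Ax^k+z_2(\lambda)A\tilde u_{k,\epsilon})-2g_i(Ax^k)}{\alpha_i^k}.$$ Compute $\lambda^{k,\epsilon,\delta}\in\Delta_m$ such that, with $z_j=z_j(\lambda^{k,\epsilon,\delta})$, $d_S^{k,\epsilon,\delta}:=z_1v_{k,\epsilon}+z_2\tilde u_{k,\epsilon}$ and $w=\lambda^{k,\epsilon,\delta}/\alpha^k$, $$\mathcal{D}^k(\lambda^{k,\epsilon,\delta})\le(1-\delta)\left(\langle\nabla f_w(x^k),d_S^{k,\epsilon,\delta}\rangle+g_w(Ax^k+z_1Av_{k,\epsilon})+g_w(Ax^k+z_2A\tilde u_{k,\epsilon})-2g_w(Ax^k)\right).$$ Set $d_k=\frac12d_S^{k,\epsilon,\delta}$. 5. Let $t_k$ be the largest $\gamma^j$, $j\in\{0,1,2,\dots\}$, with $F_i^A(x^k+\gamma^jd_k)-F_i^A(x^k)\le\sigma\gamma^j\left(\langle\nabla f_i(x^k),d_k\rangle+g_i(Ax^k+Ad_k)-g_i(Ax^k)\right)$ for all $i\in[m]$. Set $x^{k+1}=x^k+t_kd_k$. The algorithm is assumed not to stop, so that $\{x^k\}$ is infinite. *)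

theory Defs
  imports "HOL-Analysis.Analysis"
begin

section \<open>Composite multiobjective problems\<close>

text \<open>Objectives are indexed by a finite type \<open>'m\<close>.  The maps \<open>g i\<close> take values in
  \<^typ>\<open>ereal\<close>; the value \<open>-\<infinity>\<close> is excluded by \<open>proper_fun\<close>.\<close>

definition edom :: "('a \<Rightarrow> ereal) \<Rightarrow> 'a set" where
  "edom h = {y. h y < \<infinity>}"

definition proper_fun :: "('a \<Rightarrow> ereal) \<Rightarrow> bool" where
  "proper_fun h \<longleftrightarrow> (\<forall>y. h y \<noteq> -\<infinity>) \<and> edom h \<noteq> {}"

definition convex_fun :: "('a::real_vector \<Rightarrow> ereal) \<Rightarrow> bool" where
  "convex_fun h \<longleftrightarrow> (\<forall>x y. \<forall>u\<ge>0. \<forall>v\<ge>0. u + v = 1 \<longrightarrow>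
     h (u *\<^sub>R x + v *\<^sub>R y) \<le> ereal u * h x + ereal v * h y)"

definition lsc_fun :: "('a::topological_space \<Rightarrow> ereal) \<Rightarrow> bool" where
  "lsc_fun h \<longleftrightarrow> (\<forall>y. h y \<le> Liminf (at y) h)"

definition C1_with_gradient :: "('a::real_inner \<Rightarrow> real) \<Rightarrow> ('a \<Rightarrow> 'a) \<Rightarrow> bool" where
  "C1_with_gradient h grad \<longleftrightarrow> (\<forall>x. GDERIV h x :> grad x) \<and> continuous_on UNIV grad"

definition L_smooth :: "('a::real_inner \<Rightarrow> real) \<Rightarrow> ('a \<Rightarrow> 'a) \<Rightarrow> real \<Rightarrow> bool" where
  "L_smooth h grad L \<longleftrightarrow>
     (\<forall>x y. h y \<le> h x + grad x \<bullet> (y - x) + L / 2 * (norm (y - x))\<^sup>2)"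

definition composite ::
  "('m \<Rightarrow> real^'n \<Rightarrow> real) \<Rightarrow> ('m \<Rightarrow> real^'p \<Rightarrow> ereal) \<Rightarrow> real^'n^'p \<Rightarrow> 'm \<Rightarrow> real^'n \<Rightarrow> ereal" where
  "composite f g A i x = ereal (f i x) + g i (A *v x)"

definition composite_dom :: "('m \<Rightarrow> real^'p \<Rightarrow> ereal) \<Rightarrow> real^'n^'p \<Rightarrow> (real^'n) set" where
  "composite_dom g A = {x. A *v x \<in> (\<Inter>i. edom (g i))}"

definition level_set :: "('m \<Rightarrow> 'a \<Rightarrow> ereal) \<Rightarrow> 'a \<Rightarrow> 'a set" where
  "level_set F x0 = {x. \<forall>i. F i x \<le> F i x0}"

text \<open>One-sided directional derivatives are extended reals: along a direction leaving the domain
  the value is \<open>\<infinity>\<close>, and \<open>-\<infinity>\<close> is possible at the boundary of the domain.\<close>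

definition has_dir_deriv ::
  "('a::real_normed_vector \<Rightarrow> ereal) \<Rightarrow> 'a \<Rightarrow> 'a \<Rightarrow> ereal \<Rightarrow> bool" where
  "has_dir_deriv h x d l \<longleftrightarrow>
     ((\<lambda>t. (h (x + t *\<^sub>R d) - h x) / ereal t) \<longlongrightarrow> l) (at_right 0)"

text \<open>Finiteness of \<open>F\<close> at the point is required, since otherwise the difference quotients are
  meaningless; existence of all directional derivatives is part of the notion.\<close>

definition pareto_critical ::
  "('m::finite \<Rightarrow> 'a::real_normed_vector \<Rightarrow> ereal) \<Rightarrow> 'a \<Rightarrow> bool" where
  "pareto_critical F x \<longleftrightarrow> (\<forall>i. \<bar>F i x\<bar> \<noteq> \<infinity>) \<and>
     (\<forall>d. \<exists>l. (\<forall>i. has_dir_deriv (F i) x d (l i)) \<and> 0 \<le> (MAX i. l i))"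

definition accumulation_point :: "(nat \<Rightarrow> 'a::topological_space) \<Rightarrow> 'a \<Rightarrow> bool" where
  "accumulation_point x l \<longleftrightarrow> (\<exists>r. strict_mono r \<and> (x \<circ> r) \<longlonglongrightarrow> l)"

section \<open>Weighted functions, matrices, safeguards\<close>

definition unit_simplex :: "(real^'m) set" where
  "unit_simplex = {w. (\<forall>i. 0 \<le> w $ i) \<and> (\<Sum>i\<in>UNIV. w $ i) = 1}"

definition cdiv :: "real^'m \<Rightarrow> real^'m \<Rightarrow> real^'m" (infixl \<open>\<oslash>\<close> 70) where
  "w \<oslash> a = (\<chi> i. w $ i / a $ i)"

definition wgrad :: "('m::finite \<Rightarrow> real^'n \<Rightarrow> real^'n) \<Rightarrow> real^'m \<Rightarrow> real^'n \<Rightarrow> real^'n" where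
  "wgrad grad w x = (\<Sum>i\<in>UNIV. w $ i *\<^sub>R grad i x)"

text \<open>The case distinction is needed: \<open>0 * \<infinity> = 0\<close> in \<^typ>\<open>ereal\<close>, whereas a weighted sum is
  \<open>\<infinity>\<close> wherever some \<open>g i\<close> is, even if its weight vanishes.\<close>

definition wsum :: "('m::finite \<Rightarrow> 'b \<Rightarrow> ereal) \<Rightarrow> real^'m \<Rightarrow> 'b \<Rightarrow> ereal" where
  "wsum g w y = (if \<exists>i. g i y = \<infinity> then \<infinity> else (\<Sum>i\<in>UNIV. ereal (w $ i) * g i y))"

definition jacobian :: "('m \<Rightarrow> real^'n \<Rightarrow> real^'n) \<Rightarrow> real^'n \<Rightarrow> real^'n^'m" where
  "jacobian grad x = (\<chi> i. grad i x)"

definition loewner_le :: "real^'n^'n \<Rightarrow> real^'n^'n \<Rightarrow> bool" where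
  "loewner_le M N \<longleftrightarrow> (\<forall>y. 0 \<le> y \<bullet> ((N - M) *v y))"

definition mnorm :: "real^'n^'n \<Rightarrow> real^'n \<Rightarrow> real" where
  "mnorm P x = sqrt (x \<bullet> (P *v x))"

text \<open>The safeguarded quotient common to all step-size formulas: \<open>a\<close> is the inner product whose
  sign is tested, \<open>p\<close> the quotient for positive sign and \<open>n\<close> the one for negative sign.\<close>

definition safeguard :: "real \<Rightarrow> real \<Rightarrow> real \<Rightarrow> real \<Rightarrow> real \<Rightarrow> real" where
  "safeguard lo hi a p n =
     (if a > 0 then max lo (min p hi) else if a < 0 then max lo (min n hi) else lo)"

section \<open>The inexact subspace preconditioned proximal Barzilai--Borwein iteration\<close>

text \<open>Correspondence with the usual symbols:
  \<open>xm1\<close> is \<open>x^(-1)\<close>,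
  \<open>lamP k\<close> is \<open>\<lambda>^(k,\<epsilon>)_PBB\<close>,
  \<open>v k\<close> is \<open>v_(k,\<epsilon>)\<close>,
  \<open>lam k\<close> is \<open>\<lambda>^(k,\<epsilon>,\<delta>)\<close>,
  \<open>\<alpha> k\<close> is \<open>\<alpha>^k\<close>,
  \<open>\<eta> k\<close> is the difference parameter \<open>\<epsilon>_k\<close>,
  \<open>z1 k\<close> and \<open>z2 k\<close> are \<open>z_1\<close> and \<open>z_2\<close> at \<open>lam k\<close>.
  The differences \<open>s\<close> and \<open>y\<close> are indexed by the iteration using them:
  \<open>s k = x^k - x^(k-1)\<close>.\<close>

locale sppbb_data =
  fixes A :: "real^'n^'p"
    and f :: "'m::finite \<Rightarrow> real^'n \<Rightarrow> real"
    and grad :: "'m \<Rightarrow> real^'n \<Rightarrow> real^'n"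
    and g :: "'m \<Rightarrow> real^'p \<Rightarrow> ereal"
    and \<epsilon> \<delta> c1 c2 c3 c4 \<sigma> \<gamma> \<alpha>min \<alpha>max :: real
    and xm1 :: "real^'n"
    and x :: "nat \<Rightarrow> real^'n"
    and P :: "nat \<Rightarrow> real^'n^'n"
    and lamP :: "nat \<Rightarrow> real^'m"
    and v :: "nat \<Rightarrow> real^'n"
    and u :: "nat \<Rightarrow> real^'n"
    and \<eta> :: "nat \<Rightarrow> real"
    and \<alpha> :: "nat \<Rightarrow> real^'m"
    and lam :: "nat \<Rightarrow> real^'m"
    and z1 z2 :: "nat \<Rightarrow> real"
begin

definition s :: "nat \<Rightarrow> real^'n" where
  "s k = x k - (if k = 0 then xm1 else x (k - 1))"

definition y :: "'m \<Rightarrow> nat \<Rightarrow> real^'n" where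
  "y i k = grad i (x k) - grad i (if k = 0 then xm1 else x (k - 1))"

definition \<alpha>P :: "nat \<Rightarrow> real^'m" where
  "\<alpha>P k = (\<chi> i. safeguard \<alpha>min \<alpha>max (s k \<bullet> y i k)
      ((s k \<bullet> y i k) / (mnorm (P k) (s k))\<^sup>2)
      (norm (y i k) / norm (P k *v s k)))"

definition prox_obj :: "nat \<Rightarrow> real^'m \<Rightarrow> real^'n \<Rightarrow> ereal" where
  "prox_obj k l x' = ereal (wgrad grad (l \<oslash> \<alpha>P k) (x k) \<bullet> (x' - x k))
      + wsum g (l \<oslash> \<alpha>P k) (A *v x') - wsum g (l \<oslash> \<alpha>P k) (A *v x k)
      + ereal (1 / 2 * (mnorm (P k) (x' - x k))\<^sup>2)"

text \<open>\<open>DPBB k x'\<close> is \<open>D^k_PBB(\<lambda>)\<close> expressed through the point \<open>x' = x(\<lambda>)\<close>; likewise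
  \<open>DS k \<zeta>1 \<zeta>2\<close> is \<open>D^k(\<lambda>)\<close> expressed through \<open>\<zeta>1 = z_1(\<lambda>)\<close>, \<open>\<zeta>2 = z_2(\<lambda>)\<close>.\<close>

definition DPBB :: "nat \<Rightarrow> real^'n \<Rightarrow> ereal" where
  "DPBB k x' = (MAX i. (ereal (grad i (x k) \<bullet> (x' - x k)) + g i (A *v x') - g i (A *v x k))
      / ereal (\<alpha>P k $ i))"

definition B :: "nat \<Rightarrow> real^'n \<Rightarrow> real^'n" where
  "B k r = (1 / \<eta> k) *\<^sub>R (wgrad grad (lam (k - 1) \<oslash> \<alpha> (k - 1)) (x k + \<eta> k *\<^sub>R r)
      - wgrad grad (lam (k - 1) \<oslash> \<alpha> (k - 1)) (x k))"

definition q :: "nat \<Rightarrow> real^'n \<Rightarrow> real" where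
  "q k r = safeguard c1 c2 (r \<bullet> B k r) ((r \<bullet> B k r) / (norm r)\<^sup>2) (norm (B k r) / norm r)"

definition ut :: "nat \<Rightarrow> real^'n" where
  "ut k = u k - ((u k \<bullet> B k (v k)) / (q k (v k) * (norm (v k))\<^sup>2)) *\<^sub>R v k"

definition ray_obj :: "nat \<Rightarrow> real^'m \<Rightarrow> real^'n \<Rightarrow> real \<Rightarrow> ereal" where
  "ray_obj k l r z = ereal ((l \<oslash> \<alpha> k) \<bullet> (z *\<^sub>R (jacobian grad (x k) *v r)))
      + wsum g (l \<oslash> \<alpha> k) (A *v x k + z *\<^sub>R (A *v r))
      + ereal (q k r / 2 * (norm r)\<^sup>2 * z\<^sup>2)"

definition DS :: "nat \<Rightarrow> real \<Rightarrow> real \<Rightarrow> ereal" where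
  "DS k \<zeta>1 \<zeta>2 = (MAX i. (ereal (grad i (x k) \<bullet> (\<zeta>1 *\<^sub>R v k + \<zeta>2 *\<^sub>R ut k))
      + g i (A *v x k + \<zeta>1 *\<^sub>R (A *v v k)) + g i (A *v x k + \<zeta>2 *\<^sub>R (A *v ut k))
      - 2 * g i (A *v x k)) / ereal (\<alpha> k $ i))"

definition dS :: "nat \<Rightarrow> real^'n" where
  "dS k = z1 k *\<^sub>R v k + z2 k *\<^sub>R ut k"

definition d :: "nat \<Rightarrow> real^'n" where
  "d k = (if k = 0 then v 0 else (1 / 2) *\<^sub>R dS k)"

definition armijo :: "nat \<Rightarrow> nat \<Rightarrow> bool" where
  "armijo k j \<longleftrightarrow> (\<forall>i.
      composite f g A i (x k + \<gamma> ^ j *\<^sub>R d k) - composite f g A i (x k)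
      \<le> ereal (\<sigma> * \<gamma> ^ j) *
        (ereal (grad i (x k) \<bullet> d k) + g i (A *v x k + A *v d k) - g i (A *v x k)))"

text \<open>For \<open>0 < \<gamma> < 1\<close> the largest admissible power has the least exponent.\<close>

definition t :: "nat \<Rightarrow> real" where
  "t k = \<gamma> ^ (LEAST j. armijo k j)"

end

text \<open>Minimizers and projections are described by \<^const>\<open>is_arg_min\<close> at the multipliers actually
  chosen by the iteration, so no existence is assumed for other multipliers (\<open>wsum g w\<close> need not
  be lower semicontinuous when \<open>w\<close> has zero entries).\<close>

locale sppbb_run =
  sppbb_data A f grad g \<epsilon> \<delta> c1 c2 c3 c4 \<sigma> \<gamma> \<alpha>min \<alpha>max xm1 x P lamP v u \<eta> \<alpha> lam z1 z2
  for A :: "real^'n^'p"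
    and f :: "'m::finite \<Rightarrow> real^'n \<Rightarrow> real"
    and grad :: "'m \<Rightarrow> real^'n \<Rightarrow> real^'n"
    and g :: "'m \<Rightarrow> real^'p \<Rightarrow> ereal"
    and \<epsilon> \<delta> c1 c2 c3 c4 \<sigma> \<gamma> \<alpha>min \<alpha>max :: real
    and xm1 :: "real^'n"
    and x :: "nat \<Rightarrow> real^'n"
    and P :: "nat \<Rightarrow> real^'n^'n"
    and lamP :: "nat \<Rightarrow> real^'m"
    and v :: "nat \<Rightarrow> real^'n"
    and u :: "nat \<Rightarrow> real^'n"
    and \<eta> :: "nat \<Rightarrow> real"
    and \<alpha> :: "nat \<Rightarrow> real^'m"
    and lam :: "nat \<Rightarrow> real^'m"
    and z1 z2 :: "nat \<Rightarrow> real" +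
  assumes P_sym: "transpose (P k) = P k"
    and P_lower: "loewner_le (c3 *\<^sub>R mat 1) (P k)"
    and P_upper: "loewner_le (P k) (c4 *\<^sub>R mat 1)"
    and lamP_simplex: "lamP k \<in> unit_simplex"
    and v_prox: "is_arg_min (prox_obj k (lamP k)) (\<lambda>_. True) (x k + v k)"
    and v_inexact: "DPBB k (x k + v k) \<le> ereal (1 - \<epsilon>) *
      (ereal (wgrad grad (lamP k \<oslash> \<alpha>P k) (x k) \<bullet> v k)
       + wsum g (lamP k \<oslash> \<alpha>P k) (A *v x k + A *v v k) - wsum g (lamP k \<oslash> \<alpha>P k) (A *v x k))"
    and no_stop: "v k \<noteq> 0"
    and lam_0: "lam 0 = lamP 0"
    and \<alpha>_0: "\<alpha> 0 = \<alpha>P 0"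
    and u_proj: "1 \<le> k \<Longrightarrow> is_arg_min (\<lambda>r. mnorm (P k) (r - (x k + s k)))
      (\<lambda>r. r \<in> (\<Inter>i. edom (\<lambda>r. g i (A *v r)))) (x k + u k)"
    and \<eta>_pos: "1 \<le> k \<Longrightarrow> 0 < \<eta> k"
    and \<alpha>_step: "1 \<le> k \<Longrightarrow> \<alpha> k = (\<chi> i. safeguard \<alpha>min \<alpha>max (s k \<bullet> y i k)
      ((s k \<bullet> y i k) / (q k (s k) * (norm (s k))\<^sup>2))
      (norm (y i k) / (q k (s k) * norm (s k))))"
    and lam_simplex: "1 \<le> k \<Longrightarrow> lam k \<in> unit_simplex"
    and z1_min: "1 \<le> k \<Longrightarrow> is_arg_min (ray_obj k (lam k) (v k)) (\<lambda>_. True) (z1 k)"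
    and z2_min: "1 \<le> k \<Longrightarrow> is_arg_min (ray_obj k (lam k) (ut k)) (\<lambda>_. True) (z2 k)"
    and dS_inexact: "1 \<le> k \<Longrightarrow> DS k (z1 k) (z2 k) \<le> ereal (1 - \<delta>) *
      (ereal (wgrad grad (lam k \<oslash> \<alpha> k) (x k) \<bullet> dS k)
       + wsum g (lam k \<oslash> \<alpha> k) (A *v x k + z1 k *\<^sub>R (A *v v k))
       + wsum g (lam k \<oslash> \<alpha> k) (A *v x k + z2 k *\<^sub>R (A *v ut k))
       - 2 * wsum g (lam k \<oslash> \<alpha> k) (A *v x k))"
    and x_step: "x (Suc k) = x k + t k *\<^sub>R d k"

end

theory Submission
  imports Defs
begin

text \<open>
  Write \<open>H i = g i \<circ> A\<close> and measure the predicted change of the \<open>i\<close>-th objective along a step \<open>r\<close>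
  from \<open>p\<close> by the convex model \<open>model i p r = grad i p \<bullet> r + H i (p + r) - H i p\<close>.  The quantity that
  drives the proof is \<open>\<theta> k\<close>, the weighted sum of the models at the proximal step \<open>v k\<close>.  Since \<open>v k\<close>
  minimizes a weighted model plus \<open>(mnorm (P k) r)\<^sup>2 / 2\<close>, strong convexity gives
  \<open>\<theta> k \<le> - (c3 * (norm (v k))\<^sup>2) \<le> 0\<close> (\<open>\<theta>_le\<close>), and the inexactness criterion turns the decrease of the
  weighted sum into one of every single model (\<open>model_v_le\<close>).

  The subspace step inherits this.  Moving along \<open>v k\<close> by a suitable fixed fraction is a candidate in
  the one-dimensional problem for \<open>z1 k\<close>, and its quadratic penalty is absorbed because \<open>c3\<close> times
  the squared norm of \<open>v k\<close> is at most \<open>- \<theta> k\<close> (\<open>subspace_model_le_prox\<close>).  The second ray can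
  only help, whatever its direction, as the value at its minimizer is at most the value \<open>0\<close> at the
  origin.  Averaging the two steps and using convexity once more (at the first iteration, where
  \<open>d 0 = v 0\<close>, directly), every model at \<open>d k\<close> is below both a
  fixed multiple of \<open>\<theta> k\<close> and a fixed negative multiple of the squared norm of \<open>d k\<close> (\<open>uniform_model_decrease\<close>).  By \<open>L\<close>-smoothness the second bound makes one
  exponent acceptable to the line search at all iterations, so step lengths stay away from \<open>0\<close>; the
  first bound then makes every objective drop by a fixed multiple of \<open>- \<theta> k\<close> (\<open>descent\<close>).

  Iterates therefore stay in a compact level set, which gives accumulation points.  At an accumulation
  point the objectives are finite and, being lower semicontinuous, bound the values along the run from
  below; so \<open>\<theta>\<close> tends to \<open>0\<close>.  If some direction decreased all models at the accumulation point, a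
  short enough move in that direction would keep the proximal objective at nearby iterates below a
  fixed negative number, although it is bounded below by \<open>\<theta> k\<close> (\<open>no_common_descent\<close>).
  Finally, monotone difference quotients of convex functions yield the directional derivatives, and
  if all of them were negative then all models would be negative at a common short step.
\<close>

section \<open>Convex extended-real functions and elementary estimates\<close>

lemma convex_fun_comp_matrix:
  fixes A :: "real^'n^'p"
  assumes "convex_fun h"
  shows "convex_fun (\<lambda>r. h (A *v r))"
  using assms by (simp add: convex_fun_def matrix_vector_right_distrib matrix_vector_mult_scaleR)

lemma lsc_fun_eventually_greater:
  assumes "lsc_fun h" and "c < h z"
  shows "eventually (\<lambda>r. c < h r) (nhds z)"
proof -
  have "eventually (\<lambda>r. c < h r) (at z)"
    using assms le_Liminf_iff unfolding lsc_fun_def by blast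
  then show ?thesis
    unfolding eventually_at_filter using assms(2) by (auto elim!: eventually_mono)
qed

lemma convex_fun_quotient_mono:
  fixes h :: "'a::real_normed_vector \<Rightarrow> ereal"
  assumes cv: "convex_fun h" and nm: "\<And>r. h r \<noteq> -\<infinity>" and fin: "\<bar>h p\<bar> \<noteq> \<infinity>"
    and st: "0 < s" "s \<le> t"
  shows "(h (p + s *\<^sub>R r) - h p) / ereal s \<le> (h (p + t *\<^sub>R r) - h p) / ereal t"
proof (cases "h (p + t *\<^sub>R r)")
  case PInf
  then show ?thesis using fin st by (cases "h p") auto
next
  case MInf
  then show ?thesis using nm by simp
next
  case (real b)
  obtain a where a: "h p = ereal a" using fin by auto
  have e: "(1 - s / t) *\<^sub>R p + (s / t) *\<^sub>R (p + t *\<^sub>R r) = p + s *\<^sub>R r"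
    using st by (simp add: algebra_simps)
  have "h ((1 - s / t) *\<^sub>R p + (s / t) *\<^sub>R (p + t *\<^sub>R r))
      \<le> ereal (1 - s / t) * h p + ereal (s / t) * h (p + t *\<^sub>R r)"
    using cv st unfolding convex_fun_def by simp
  then have le: "h (p + s *\<^sub>R r) \<le> ereal ((1 - s / t) * a + (s / t) * b)"
    unfolding e a real by simp
  then obtain c where c: "h (p + s *\<^sub>R r) = ereal c" using nm
    by (cases "h (p + s *\<^sub>R r)") auto
  have "c - a \<le> s * ((b - a) / t)" using le c st by (simp add: field_simps)
  then have "(c - a) / s \<le> (b - a) / t" using st by (simp add: pos_divide_le_eq mult.commute)
  then show ?thesis using st by (simp add: a c real)
qed

text \<open>Monotone difference quotients converge to their infimum.  It may be \<open>\<infinity>\<close>, along directions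
  leaving the domain, or \<open>-\<infinity>\<close>, at points on the boundary of the domain.\<close>

lemma convex_fun_quotient_tendsto:
  fixes h :: "'a::real_normed_vector \<Rightarrow> ereal"
  assumes cv: "convex_fun h" and nm: "\<And>r. h r \<noteq> -\<infinity>" and fin: "\<bar>h p\<bar> \<noteq> \<infinity>"
  shows "((\<lambda>t. (h (p + t *\<^sub>R r) - h p) / ereal t) \<longlongrightarrow>
      (INF t\<in>{0<..}. (h (p + t *\<^sub>R r) - h p) / ereal t)) (at_right 0)"
    (is "(?\<phi> \<longlongrightarrow> ?l) _")
proof (rule order_tendstoI)
  fix a assume "a < ?l"
  then have "a < ?\<phi> t" if "0 < t" for t
    using that by (meson INF_lower greaterThan_iff less_le_trans)
  then show "eventually (\<lambda>t. a < ?\<phi> t) (at_right 0)"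
    by (auto simp: eventually_at_right_field intro: exI[of _ 1])
next
  fix a assume "?l < a"
  then obtain t0 where t0: "0 < t0" "?\<phi> t0 < a" by (auto simp: INF_less_iff)
  then have "?\<phi> t < a" if "0 < t" "t < t0" for t
    using convex_fun_quotient_mono[OF cv nm fin, of t t0 r] that by (auto intro: le_less_trans)
  then show "eventually (\<lambda>t. ?\<phi> t < a) (at_right 0)"
    using t0(1) unfolding eventually_at_right_field by blast
qed

lemma has_dir_deriv_smooth_plus_convex:
  fixes h :: "'a::real_inner \<Rightarrow> ereal"
  assumes cv: "convex_fun h" and nm: "\<And>r. h r \<noteq> -\<infinity>" and fin: "\<bar>h p\<bar> \<noteq> \<infinity>"
    and df: "GDERIV \<phi> p :> G"
  shows "has_dir_deriv (\<lambda>z. ereal (\<phi> z) + h z) p r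
    (ereal (G \<bullet> r) + (INF t\<in>{0<..}. (h (p + t *\<^sub>R r) - h p) / ereal t))"
proof -
  have "((\<lambda>t. p + t *\<^sub>R r) has_derivative (\<lambda>t. t *\<^sub>R r)) (at 0)"
    by (auto intro!: derivative_eq_intros)
  moreover have "(\<phi> has_derivative (\<lambda>z. z \<bullet> G)) (at (p + 0 *\<^sub>R r))"
    using df by (simp add: gderiv_def)
  ultimately have "((\<lambda>t. \<phi> (p + t *\<^sub>R r)) has_derivative (\<lambda>t. t *\<^sub>R r \<bullet> G)) (at 0)"
    by (rule has_derivative_compose)
  then have "((\<lambda>t. \<phi> (p + t *\<^sub>R r)) has_real_derivative (G \<bullet> r)) (at 0)"
    by (simp add: has_field_derivative_def mult_commute_abs inner_commute)
  then have "((\<lambda>t. (\<phi> (p + t *\<^sub>R r) - \<phi> p) / t) \<longlongrightarrow> G \<bullet> r) (at_right 0)"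
    by (auto simp: DERIV_def intro: filterlim_mono[OF _ order_refl at_le])
  then have "((\<lambda>t. ereal ((\<phi> (p + t *\<^sub>R r) - \<phi> p) / t)) \<longlongrightarrow> ereal (G \<bullet> r)) (at_right 0)"
    by simp
  then have "((\<lambda>t. ereal ((\<phi> (p + t *\<^sub>R r) - \<phi> p) / t) + (h (p + t *\<^sub>R r) - h p) / ereal t) \<longlongrightarrow>
      ereal (G \<bullet> r) + (INF t\<in>{0<..}. (h (p + t *\<^sub>R r) - h p) / ereal t)) (at_right 0)"
    by (intro tendsto_add_ereal_general convex_fun_quotient_tendsto assms) auto
  moreover
  have "ereal ((\<phi> (p + t *\<^sub>R r) - \<phi> p) / t) + (h (p + t *\<^sub>R r) - h p) / ereal t =
      (ereal (\<phi> (p + t *\<^sub>R r)) + h (p + t *\<^sub>R r) - (ereal (\<phi> p) + h p)) / ereal t"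
    if "0 < t" for t
    using that fin nm[of "p + t *\<^sub>R r"]
    by (cases "h p"; cases "h (p + t *\<^sub>R r)") (auto simp: field_simps)
  then have "eventually (\<lambda>t. ereal ((\<phi> (p + t *\<^sub>R r) - \<phi> p) / t)
        + (h (p + t *\<^sub>R r) - h p) / ereal t =
      (ereal (\<phi> (p + t *\<^sub>R r)) + h (p + t *\<^sub>R r) - (ereal (\<phi> p) + h p)) / ereal t) (at_right 0)"
    by (auto simp: eventually_at_right_field intro: exI[of _ 1])
  ultimately show ?thesis
    unfolding has_dir_deriv_def by (rule Lim_transform_eventually)
qed

text \<open>The form in which strong convexity is used.  Here \<open>a\<close> is the value of a convex function
  vanishing at the origin and \<open>N\<close> a squared norm, both at a minimizer of the function plus half the
  squared norm; the right-hand side bounds that objective at the minimizer scaled by \<open>\<tau>\<close>.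
  Comparison with the origin alone would lose a factor \<open>2\<close>; letting \<open>\<tau>\<close> tend to \<open>1\<close> recovers it.\<close>

lemma descent_from_quadratic_minimality:
  fixes a N :: real
  assumes "\<And>\<tau>. 0 < \<tau> \<Longrightarrow> \<tau> < 1 \<Longrightarrow> a + N / 2 \<le> \<tau> * a + \<tau>\<^sup>2 * (N / 2)"
  shows "a \<le> - N"
proof -
  have *: "a \<le> - ((1 + \<tau>) / 2 * N)" if "0 < \<tau>" "\<tau> < 1" for \<tau>
  proof -
    have "(1 - \<tau>) * (a + (1 + \<tau>) / 2 * N) = (a + N / 2) - (\<tau> * a + \<tau>\<^sup>2 * (N / 2))"
      by (simp add: field_simps power2_eq_square)
    then have "(1 - \<tau>) * (a + (1 + \<tau>) / 2 * N) \<le> 0" using assms[OF that] by simp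
    then show ?thesis using that by (simp add: mult_le_0_iff)
  qed
  have "((\<lambda>\<tau>. - ((1 + \<tau>) / 2 * N)) \<longlongrightarrow> - ((1 + 1) / 2 * N)) (at_left (1::real))"
    by (intro tendsto_intros) auto
  then have "a \<le> - ((1 + 1) / 2 * N)"
    by (rule tendsto_lowerbound)
       (use * in \<open>auto simp: eventually_at_left_field intro!: exI[of _ 0]\<close>)
  then show ?thesis by simp
qed

lemma norm_add_square_le:
  fixes a b :: "'a::real_inner"
  shows "(norm (a + b))\<^sup>2 \<le> 2 * (norm a)\<^sup>2 + 2 * (norm b)\<^sup>2"
  using zero_le_power2[of "norm (a - b)"]
  by (simp add: power2_norm_eq_inner inner_add inner_diff inner_commute)

lemma safeguard_bounds:
  assumes "lo \<le> hi"
  shows "lo \<le> safeguard lo hi a p n" "safeguard lo hi a p n \<le> hi"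
  using assms by (auto simp: safeguard_def)

lemma mnorm_square_bounds:
  assumes "loewner_le (c *\<^sub>R mat 1) P" and "loewner_le P (C *\<^sub>R mat 1)" and "0 \<le> c"
  shows "c * (norm r)\<^sup>2 \<le> (mnorm P r)\<^sup>2" "(mnorm P r)\<^sup>2 \<le> C * (norm r)\<^sup>2"
proof -
  have lo: "c * (norm r)\<^sup>2 \<le> r \<bullet> (P *v r)" and hi: "r \<bullet> (P *v r) \<le> C * (norm r)\<^sup>2"
    using assms(1,2)
    by (auto simp: loewner_le_def matrix_vector_mult_diff_rdistrib inner_diff_right
        scaleR_matrix_vector_assoc[symmetric] power2_norm_eq_inner)
  moreover have "0 \<le> r \<bullet> (P *v r)" using lo assms(3) by (meson order_trans mult_nonneg_nonneg zero_le_power2)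
  ultimately show "c * (norm r)\<^sup>2 \<le> (mnorm P r)\<^sup>2" "(mnorm P r)\<^sup>2 \<le> C * (norm r)\<^sup>2"
    by (auto simp: mnorm_def)
qed

lemma sum_cdiv_ge:
  fixes w a :: "real^'m::finite"
  assumes "w \<in> unit_simplex" and "\<And>i. 0 < a $ i" "\<And>i. a $ i \<le> b"
  shows "1 / b \<le> (\<Sum>i\<in>UNIV. (w \<oslash> a) $ i)"
proof -
  have "1 / b = (\<Sum>i\<in>UNIV. w $ i / b)"
    using assms(1) by (simp add: unit_simplex_def flip: sum_divide_distrib)
  also have "\<dots> \<le> (\<Sum>i\<in>UNIV. (w \<oslash> a) $ i)"
    using assms by (intro sum_mono) (auto simp: cdiv_def unit_simplex_def intro!: divide_left_mono
        mult_pos_pos intro: less_le_trans)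
  finally show ?thesis .
qed

lemma cdiv_nonneg:
  fixes w a :: "real^'m::finite"
  assumes "w \<in> unit_simplex" and "\<And>i. 0 < a $ i"
  shows "0 \<le> (w \<oslash> a) $ i"
  using assms by (auto simp: cdiv_def unit_simplex_def less_imp_le)


section \<open>Finite-valued form of the iteration\<close>

locale sppbb_convergence =
  sppbb_run A f grad g \<epsilon> \<delta> c1 c2 c3 c4 \<sigma> \<gamma> \<alpha>min \<alpha>max xm1 x P lamP v u \<eta> \<alpha> lam z1 z2
  for A :: "real^'n^'p"
    and f :: "'m::finite \<Rightarrow> real^'n \<Rightarrow> real"
    and grad g \<epsilon> \<delta> c1 c2 c3 c4 \<sigma> \<gamma> \<alpha>min \<alpha>max xm1 x P lamP v u \<eta> \<alpha> lam z1 z2 +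
  fixes L :: "'m \<Rightarrow> real"
  assumes C1: "C1_with_gradient (f i) (grad i)"
    and proper: "proper_fun (g i)" and cvx: "convex_fun (g i)" and lsc: "lsc_fun (g i)"
    and level_compact: "x0 \<in> composite_dom g A \<Longrightarrow> compact (level_set (composite f g A) x0)"
    and smooth: "L_smooth (f i) (grad i) (L i)"
    and eps: "0 \<le> \<epsilon>" "\<epsilon> < 1" and del: "0 \<le> \<delta>" "\<delta> < 1"
    and c12: "0 < c1" "c1 \<le> c2" and c34: "0 < c3" "c3 \<le> c4"
    and sig: "0 < \<sigma>" "\<sigma> < 1" and gam: "0 < \<gamma>" "\<gamma> < 1"
    and alm: "0 < \<alpha>min" "\<alpha>min \<le> \<alpha>max"
    and x_0: "x 0 \<in> composite_dom g A"
begin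

definition D :: "(real^'n) set" where
  "D = composite_dom g A"

text \<open>Meaningful on \<^term>\<open>D\<close> only: an infinite value of \<open>g i\<close> is turned into \<open>0\<close>.\<close>

definition H :: "'m \<Rightarrow> real^'n \<Rightarrow> real" where
  "H i p = real_of_ereal (g i (A *v p))"

text \<open>The model of the change of the \<open>i\<close>-th objective in which only the smooth part is linearized; it
  is convex in \<open>r\<close>, vanishes at \<open>r = 0\<close>, and is the common building block of the proximal problem,
  the ray problems and the line search.\<close>

definition model :: "'m \<Rightarrow> real^'n \<Rightarrow> real^'n \<Rightarrow> real" where
  "model i p r = grad i p \<bullet> r + H i (p + r) - H i p"

text \<open>The optimality measure: it is nonpositive, and its convergence to \<open>0\<close> forces accumulation points
  to be critical.\<close>

definition \<theta> :: "nat \<Rightarrow> real" where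
  "\<theta> k = (\<Sum>i\<in>UNIV. (lamP k \<oslash> \<alpha>P k) $ i * model i (x k) (v k))"

lemma D_iff: "p \<in> D \<longleftrightarrow> (\<forall>i. g i (A *v p) \<noteq> \<infinity>)"
  by (auto simp: D_def composite_dom_def edom_def)

lemma g_eq: "p \<in> D \<Longrightarrow> g i (A *v p) = ereal (H i p)"
  using proper[of i] by (auto simp: D_iff H_def proper_fun_def ereal_real)

lemma wsum_eq: "p \<in> D \<Longrightarrow> wsum g w (A *v p) = ereal (\<Sum>i\<in>UNIV. w $ i * H i p)"
  by (auto simp: wsum_def g_eq)

lemma wsum_out: "p \<notin> D \<Longrightarrow> wsum g w (A *v p) = \<infinity>"
  by (auto simp: wsum_def D_iff)

lemma composite_eq: "p \<in> D \<Longrightarrow> composite f g A i p = ereal (f i p + H i p)"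
  by (simp add: composite_def g_eq)

lemma H_convex:
  assumes "p \<in> D" "r \<in> D" "0 \<le> a" "0 \<le> b" "a + b = 1"
  shows "a *\<^sub>R p + b *\<^sub>R r \<in> D" "H i (a *\<^sub>R p + b *\<^sub>R r) \<le> a * H i p + b * H i r"
proof -
  have *: "g i (A *v (a *\<^sub>R p + b *\<^sub>R r)) \<le> ereal (a * H i p + b * H i r)" for i
    using convex_fun_comp_matrix[OF cvx[of i], of A] assms(3-5)
    unfolding convex_fun_def by (metis g_eq assms(1,2) times_ereal.simps(1) plus_ereal.simps(1))
  have "g i (A *v (a *\<^sub>R p + b *\<^sub>R r)) \<noteq> \<infinity>" for i using *[of i] by auto
  then show "a *\<^sub>R p + b *\<^sub>R r \<in> D" by (simp add: D_iff)
  from g_eq[OF this, of i] *[of i] show "H i (a *\<^sub>R p + b *\<^sub>R r) \<le> a * H i p + b * H i r" by simp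
qed

lemma model_scale:
  assumes "p \<in> D" "p + r \<in> D" "0 \<le> \<tau>" "\<tau> \<le> 1"
  shows "p + \<tau> *\<^sub>R r \<in> D" "model i p (\<tau> *\<^sub>R r) \<le> \<tau> * model i p r"
proof -
  have e: "(1 - \<tau>) *\<^sub>R p + \<tau> *\<^sub>R (p + r) = p + \<tau> *\<^sub>R r" by (simp add: algebra_simps)
  show "p + \<tau> *\<^sub>R r \<in> D" "model i p (\<tau> *\<^sub>R r) \<le> \<tau> * model i p r"
    using H_convex[OF assms(1,2), of "1 - \<tau>" \<tau>, unfolded e] assms(3,4)
    by (auto simp: model_def algebra_simps)
qed

lemma model_midpoint:
  assumes "p \<in> D" "p + a \<in> D" "p + b \<in> D"
  shows "p + (1 / 2) *\<^sub>R (a + b) \<in> D"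
    and "model i p ((1 / 2) *\<^sub>R (a + b)) \<le> (model i p a + model i p b) / 2"
proof -
  have e: "(1 / 2) *\<^sub>R (p + a) + (1 / 2) *\<^sub>R (p + b) = p + (1 / 2) *\<^sub>R (a + b)"
    by (simp add: algebra_simps flip: scaleR_add_left)
  show "p + (1 / 2) *\<^sub>R (a + b) \<in> D"
    using H_convex(1)[OF assms(2,3), of "1/2" "1/2", unfolded e] by simp
  have "grad i p \<bullet> ((1 / 2) *\<^sub>R (a + b)) = (grad i p \<bullet> a + grad i p \<bullet> b) / 2"
    by (simp add: inner_add_right)
  moreover have "H i (p + (1 / 2) *\<^sub>R (a + b)) \<le> 1 / 2 * H i (p + a) + 1 / 2 * H i (p + b)"
    by (rule H_convex(2)[OF assms(2,3), of "1/2" "1/2" i, unfolded e]) auto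
  ultimately show "model i p ((1 / 2) *\<^sub>R (a + b)) \<le> (model i p a + model i p b) / 2"
    unfolding model_def by argo
qed

lemma \<alpha>P_bounds: "\<alpha>min \<le> \<alpha>P k $ i" "\<alpha>P k $ i \<le> \<alpha>max"
  by (simp_all add: \<alpha>P_def safeguard_bounds alm)

lemma \<alpha>_bounds: "\<alpha>min \<le> \<alpha> k $ i" "\<alpha> k $ i \<le> \<alpha>max"
  using \<alpha>P_bounds[of 0 i]
  by (cases "k = 0"; simp add: \<alpha>_0 \<alpha>_step safeguard_bounds alm)+

lemma q_bounds: "c1 \<le> q k r" "q k r \<le> c2"
  by (simp_all add: q_def safeguard_bounds c12)

lemmas mnorm_bounds = mnorm_square_bounds[OF P_lower P_upper less_imp_le[OF c34(1)]]

lemma wP_nonneg: "0 \<le> (lamP k \<oslash> \<alpha>P k) $ i"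
  by (meson cdiv_nonneg lamP_simplex \<alpha>P_bounds alm less_le_trans)

lemma wP_sum: "1 / \<alpha>max \<le> (\<Sum>i\<in>UNIV. (lamP k \<oslash> \<alpha>P k) $ i)"
  by (meson sum_cdiv_ge lamP_simplex \<alpha>P_bounds alm less_le_trans)

lemma w_nonneg: "1 \<le> k \<Longrightarrow> 0 \<le> (lam k \<oslash> \<alpha> k) $ i"
  by (meson cdiv_nonneg lam_simplex \<alpha>_bounds alm less_le_trans)

lemma w_sum: "1 \<le> k \<Longrightarrow> 1 / \<alpha>max \<le> (\<Sum>i\<in>UNIV. (lam k \<oslash> \<alpha> k) $ i)"
  by (meson sum_cdiv_ge lam_simplex \<alpha>_bounds alm less_le_trans)

lemma wgrad_inner: "wgrad grad w p \<bullet> r = (\<Sum>i\<in>UNIV. w $ i * (grad i p \<bullet> r))"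
  by (simp add: wgrad_def inner_sum_left)

lemma sum_model:
  "(\<Sum>i\<in>UNIV. w i * model i p r) =
    (\<Sum>i\<in>UNIV. w i * (grad i p \<bullet> r)) + (\<Sum>i\<in>UNIV. w i * H i (p + r)) - (\<Sum>i\<in>UNIV. w i * H i p)"
  by (simp add: model_def algebra_simps sum.distrib sum_subtractf)

lemma prox_obj_eq:
  assumes "x k \<in> D" "x k + r \<in> D"
  shows "prox_obj k l (x k + r) =
    ereal ((\<Sum>i\<in>UNIV. (l \<oslash> \<alpha>P k) $ i * model i (x k) r) + (mnorm (P k) r)\<^sup>2 / 2)"
  by (simp add: prox_obj_def wsum_eq assms wgrad_inner sum_model)

lemma ray_obj_eq:
  assumes "x k + z *\<^sub>R r \<in> D"
  shows "ray_obj k l r z =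
    ereal ((\<Sum>i\<in>UNIV. (l \<oslash> \<alpha> k) $ i * model i (x k) (z *\<^sub>R r))
      + (\<Sum>i\<in>UNIV. (l \<oslash> \<alpha> k) $ i * H i (x k)) + q k r * (norm (z *\<^sub>R r))\<^sup>2 / 2)"
proof -
  have "A *v x k + z *\<^sub>R (A *v r) = A *v (x k + z *\<^sub>R r)"
    by (simp add: matrix_vector_right_distrib matrix_vector_mult_scaleR)
  moreover have "(l \<oslash> \<alpha> k) \<bullet> (z *\<^sub>R (jacobian grad (x k) *v r)) =
      (\<Sum>i\<in>UNIV. (l \<oslash> \<alpha> k) $ i * (grad i (x k) \<bullet> (z *\<^sub>R r)))"
    by (subst inner_vec_def) (simp add: matrix_vector_mul_component jacobian_def)
  ultimately show ?thesis
    by (simp add: ray_obj_def wsum_eq assms sum_model power_mult_distrib)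
qed

section \<open>Decrease of the models\<close>

text \<open>Because the objective is finite at \<open>x k\<close> and infinite outside the domain, the minimizer lies in
  the domain, and minimality becomes an inequality between real numbers.\<close>

lemma prox_minimal:
  assumes xk: "x k \<in> D"
  shows "x k + v k \<in> D"
    and "x k + r \<in> D \<Longrightarrow> \<theta> k + (mnorm (P k) (v k))\<^sup>2 / 2 \<le>
      (\<Sum>i\<in>UNIV. (lamP k \<oslash> \<alpha>P k) $ i * model i (x k) r) + (mnorm (P k) r)\<^sup>2 / 2"
proof -
  have le: "prox_obj k (lamP k) (x k + v k) \<le> prox_obj k (lamP k) p" for p
    using v_prox[of k] by (auto simp: is_arg_min_def not_less)
  have "prox_obj k (lamP k) (x k) \<noteq> \<infinity>" using prox_obj_eq[of k 0] xk by simp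
  moreover have "prox_obj k (lamP k) p = \<infinity>" if "p \<notin> D" for p
    using that xk by (simp add: prox_obj_def wsum_eq wsum_out)
  ultimately show vD: "x k + v k \<in> D" using le[of "x k"] by (metis ereal_infty_less_eq(1))
  show "\<theta> k + (mnorm (P k) (v k))\<^sup>2 / 2 \<le>
      (\<Sum>i\<in>UNIV. (lamP k \<oslash> \<alpha>P k) $ i * model i (x k) r) + (mnorm (P k) r)\<^sup>2 / 2"
    if "x k + r \<in> D"
    using le[of "x k + r"] xk that vD by (simp add: prox_obj_eq \<theta>_def)
qed

lemma sum_model_scale:
  assumes "p \<in> D" "p + r \<in> D" "0 \<le> \<tau>" "\<tau> \<le> 1" "\<And>i. 0 \<le> w i"
  shows "(\<Sum>i\<in>UNIV. w i * model i p (\<tau> *\<^sub>R r)) \<le> \<tau> * (\<Sum>i\<in>UNIV. w i * model i p r)"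
proof -
  have "w i * model i p (\<tau> *\<^sub>R r) \<le> \<tau> * (w i * model i p r)" for i
    using mult_left_mono[OF model_scale(2)[OF assms(1-4)] assms(5)] by (simp add: mult.left_commute)
  then show ?thesis by (simp add: sum_distrib_left sum_mono)
qed

lemma \<theta>_le:
  assumes xk: "x k \<in> D"
  shows "\<theta> k \<le> - (c3 * (norm (v k))\<^sup>2)"
proof -
  have "\<theta> k \<le> - (mnorm (P k) (v k))\<^sup>2"
  proof (rule descent_from_quadratic_minimality)
    fix \<tau> :: real assume \<tau>: "0 < \<tau>" "\<tau> < 1"
    note vD = prox_minimal(1)[OF xk]
    have "(mnorm (P k) (\<tau> *\<^sub>R v k))\<^sup>2 = \<tau>\<^sup>2 * (mnorm (P k) (v k))\<^sup>2"
      by (simp add: mnorm_def matrix_vector_mult_scaleR real_sqrt_mult power_mult_distrib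
          flip: mult.assoc power2_eq_square)
    then show "\<theta> k + (mnorm (P k) (v k))\<^sup>2 / 2 \<le> \<tau> * \<theta> k + \<tau>\<^sup>2 * ((mnorm (P k) (v k))\<^sup>2 / 2)"
      using prox_minimal(2)[OF xk model_scale(1)[OF xk vD, of \<tau>]] \<tau>
        sum_model_scale[OF xk vD, of \<tau> "\<lambda>i. (lamP k \<oslash> \<alpha>P k) $ i"] wP_nonneg
      by (simp add: \<theta>_def)
  qed
  then show ?thesis using mnorm_bounds(1)[of "v k" k] by linarith
qed

lemma \<theta>_nonpos: "x k \<in> D \<Longrightarrow> \<theta> k \<le> 0"
  using \<theta>_le[of k] c34 by (meson mult_nonneg_nonneg neg_le_0_iff_le less_imp_le order_trans zero_le_power2)

text \<open>The inexactness criterion bounds the largest scaled model by \<open>1 - \<epsilon>\<close> times the weighted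
  sum \<open>\<theta> k\<close>; undoing the scaling multiplies this nonpositive bound by at least \<open>\<alpha>min\<close>.\<close>

lemma model_v_le:
  assumes xk: "x k \<in> D"
  shows "model i (x k) (v k) \<le> \<alpha>min * (1 - \<epsilon>) * \<theta> k"
proof -
  note vD = prox_minimal(1)[OF xk]
  have pos: "0 < \<alpha>P k $ i" for i using \<alpha>P_bounds(1)[of k i] alm by linarith
  have "(ereal (grad i (x k) \<bullet> (x k + v k - x k)) + g i (A *v (x k + v k)) - g i (A *v x k))
      / ereal (\<alpha>P k $ i) \<le> DPBB k (x k + v k)"
    unfolding DPBB_def by (rule Max_ge) auto
  also note v_inexact[of k]
  finally have "model i (x k) (v k) / \<alpha>P k $ i \<le> (1 - \<epsilon>) * \<theta> k"
    using pos[of i] unfolding matrix_vector_right_distrib[symmetric]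
    by (simp add: g_eq wsum_eq xk vD model_def[of i] \<theta>_def sum_model wgrad_inner)
  then have "model i (x k) (v k) \<le> \<alpha>P k $ i * ((1 - \<epsilon>) * \<theta> k)"
    using pos[of i] by (simp add: pos_divide_le_eq mult.commute)
  also have "\<dots> \<le> \<alpha>min * ((1 - \<epsilon>) * \<theta> k)"
    using \<alpha>P_bounds(1) \<theta>_nonpos[OF xk] eps
    by (intro mult_right_mono_neg) (auto simp: mult_nonneg_nonpos)
  finally show ?thesis by (simp add: mult.assoc)
qed

text \<open>One-dimensional counterpart of \<open>prox_minimal\<close> and \<open>\<theta>_le\<close>, valid for an arbitrary direction \<open>r\<close>, including \<open>r = 0\<close>.\<close>

lemma ray_minimal:
  assumes xk: "x k \<in> D" and k: "1 \<le> k" and mn: "is_arg_min (ray_obj k (lam k) r) (\<lambda>_. True) z"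
  defines "\<psi> \<equiv> \<lambda>\<zeta>. \<Sum>i\<in>UNIV. (lam k \<oslash> \<alpha> k) $ i * model i (x k) (\<zeta> *\<^sub>R r)"
  shows "x k + z *\<^sub>R r \<in> D"
    and "x k + \<zeta> *\<^sub>R r \<in> D \<Longrightarrow>
      \<psi> z + q k r * (norm (z *\<^sub>R r))\<^sup>2 / 2 \<le> \<psi> \<zeta> + q k r * (norm (\<zeta> *\<^sub>R r))\<^sup>2 / 2"
    and "\<psi> z \<le> - (c1 * (norm (z *\<^sub>R r))\<^sup>2)"
proof -
  have le: "ray_obj k (lam k) r z \<le> ray_obj k (lam k) r \<zeta>" for \<zeta>
    using mn by (auto simp: is_arg_min_def not_less)
  have "ray_obj k (lam k) r 0 \<noteq> \<infinity>" using ray_obj_eq[of k 0] xk by simp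
  moreover have "ray_obj k (lam k) r \<zeta> = \<infinity>" if "x k + \<zeta> *\<^sub>R r \<notin> D" for \<zeta>
    using wsum_out[OF that]
    by (simp add: ray_obj_def matrix_vector_right_distrib matrix_vector_mult_scaleR)
  ultimately show zD: "x k + z *\<^sub>R r \<in> D" using le[of 0] by (metis ereal_infty_less_eq(1))
  show min: "\<psi> z + q k r * (norm (z *\<^sub>R r))\<^sup>2 / 2 \<le> \<psi> \<zeta> + q k r * (norm (\<zeta> *\<^sub>R r))\<^sup>2 / 2"
    if "x k + \<zeta> *\<^sub>R r \<in> D" for \<zeta>
    using le[of \<zeta>] zD that by (simp add: ray_obj_eq \<psi>_def)
  have "\<psi> z \<le> - (q k r * (norm (z *\<^sub>R r))\<^sup>2)"
  proof (rule descent_from_quadratic_minimality)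
    fix \<tau> :: real assume \<tau>: "0 < \<tau>" "\<tau> < 1"
    have "\<psi> (\<tau> * z) \<le> \<tau> * \<psi> z"
      using sum_model_scale[OF xk zD, of \<tau> "\<lambda>i. (lam k \<oslash> \<alpha> k) $ i"] \<tau> w_nonneg[OF k]
      by (simp add: \<psi>_def)
    then show "\<psi> z + q k r * (norm (z *\<^sub>R r))\<^sup>2 / 2 \<le> \<tau> * \<psi> z + \<tau>\<^sup>2 * (q k r * (norm (z *\<^sub>R r))\<^sup>2 / 2)"
      using min[of "\<tau> * z"] model_scale(1)[OF xk zD, of \<tau>] \<tau>
      by (simp add: power_mult_distrib algebra_simps)
  qed
  moreover have "c1 * (norm (z *\<^sub>R r))\<^sup>2 \<le> q k r * (norm (z *\<^sub>R r))\<^sup>2"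
    using q_bounds by (intro mult_right_mono) auto
  ultimately show "\<psi> z \<le> - (c1 * (norm (z *\<^sub>R r))\<^sup>2)" by linarith
qed

text \<open>The averaged step \<open>d k\<close> is the midpoint of the two ray steps, so convexity of the models
  transfers the criterion for their sum to \<open>d k\<close> and contributes the factor \<open>1 / 2\<close>.\<close>

lemma subspace_model_le:
  assumes xk: "x k \<in> D" and k: "1 \<le> k"
  defines "\<psi> \<equiv> \<lambda>r. \<Sum>i\<in>UNIV. (lam k \<oslash> \<alpha> k) $ i * model i (x k) r"
  shows "x k + d k \<in> D"
    and "model i (x k) (d k) \<le> \<alpha>min * (1 - \<delta>) / 2 * (\<psi> (z1 k *\<^sub>R v k) + \<psi> (z2 k *\<^sub>R ut k))"
proof -
  note m1 = ray_minimal[OF xk k z1_min[OF k]] and m2 = ray_minimal[OF xk k z2_min[OF k]]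
  have dk: "d k = (1 / 2) *\<^sub>R (z1 k *\<^sub>R v k + z2 k *\<^sub>R ut k)" using k by (simp add: d_def dS_def)
  show "x k + d k \<in> D" unfolding dk by (rule model_midpoint[OF xk m1(1) m2(1)])
  have sq: "0 \<le> c1 * (norm r)\<^sup>2" for r :: "real^'n" using c12 by simp
  have neg: "\<psi> (z1 k *\<^sub>R v k) + \<psi> (z2 k *\<^sub>R ut k) \<le> 0"
    using m1(3) m2(3) sq[of "z1 k *\<^sub>R v k"] sq[of "z2 k *\<^sub>R ut k"] unfolding \<psi>_def by linarith
  have pos: "0 < \<alpha> k $ i" using \<alpha>_bounds(1)[of k i] alm by linarith
  have A1: "A *v x k + z *\<^sub>R (A *v r) = A *v (x k + z *\<^sub>R r)" for z r
    by (simp add: matrix_vector_right_distrib matrix_vector_mult_scaleR)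
  have "ereal ((model i (x k) (z1 k *\<^sub>R v k) + model i (x k) (z2 k *\<^sub>R ut k)) / \<alpha> k $ i) =
      (ereal (grad i (x k) \<bullet> (z1 k *\<^sub>R v k + z2 k *\<^sub>R ut k))
      + g i (A *v x k + z1 k *\<^sub>R (A *v v k)) + g i (A *v x k + z2 k *\<^sub>R (A *v ut k))
      - 2 * g i (A *v x k)) / ereal (\<alpha> k $ i)"
    unfolding A1 using pos by (simp add: g_eq xk m1(1) m2(1) model_def inner_add_right)
  also have "\<dots> \<le> DS k (z1 k) (z2 k)"
    unfolding DS_def by (rule Max_ge) auto
  also note dS_inexact[OF k]
  also have "ereal (wgrad grad (lam k \<oslash> \<alpha> k) (x k) \<bullet> dS k)
       + wsum g (lam k \<oslash> \<alpha> k) (A *v x k + z1 k *\<^sub>R (A *v v k))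
       + wsum g (lam k \<oslash> \<alpha> k) (A *v x k + z2 k *\<^sub>R (A *v ut k))
       - 2 * wsum g (lam k \<oslash> \<alpha> k) (A *v x k)
      = ereal (\<psi> (z1 k *\<^sub>R v k) + \<psi> (z2 k *\<^sub>R ut k))"
    unfolding A1 by (simp add: wsum_eq xk m1(1) m2(1) \<psi>_def sum_model wgrad_inner dS_def
        inner_add_right sum.distrib distrib_left sum_distrib_left sum_negf mult.left_commute)
  finally have "(model i (x k) (z1 k *\<^sub>R v k) + model i (x k) (z2 k *\<^sub>R ut k)) / \<alpha> k $ i
      \<le> (1 - \<delta>) * (\<psi> (z1 k *\<^sub>R v k) + \<psi> (z2 k *\<^sub>R ut k))"
    by simp
  then have "model i (x k) (z1 k *\<^sub>R v k) + model i (x k) (z2 k *\<^sub>R ut k)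
      \<le> \<alpha> k $ i * ((1 - \<delta>) * (\<psi> (z1 k *\<^sub>R v k) + \<psi> (z2 k *\<^sub>R ut k)))"
    using pos by (simp add: pos_divide_le_eq mult.commute)
  also have "\<dots> \<le> \<alpha>min * ((1 - \<delta>) * (\<psi> (z1 k *\<^sub>R v k) + \<psi> (z2 k *\<^sub>R ut k)))"
    using \<alpha>_bounds(1) neg del by (intro mult_right_mono_neg) (auto simp: mult_nonneg_nonpos)
  finally show "model i (x k) (d k) \<le> \<alpha>min * (1 - \<delta>) / 2 * (\<psi> (z1 k *\<^sub>R v k) + \<psi> (z2 k *\<^sub>R ut k))"
    using model_midpoint(2)[OF xk m1(1) m2(1), of i] unfolding dk by simp
qed


text \<open>The ray minimizer is compared with the fraction \<open>\<zeta>\<close> of the proximal step.  Along it the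
  weighted model is at most \<open>\<zeta> * \<kappa> * \<theta> k\<close>: passing from the weights of the proximal problem to those of
  the subspace problem retains at least the share \<open>\<alpha>min / \<alpha>max\<close> of the decrease.  The value of \<open>\<zeta>\<close> is
  chosen so that the quadratic penalty consumes no more than half of this.\<close>

lemma subspace_model_le_prox:
  assumes xk: "x k \<in> D" and k: "1 \<le> k"
  defines "\<kappa> \<equiv> (1 - \<epsilon>) * \<alpha>min / \<alpha>max"
  defines "\<zeta> \<equiv> min 1 (\<kappa> * c3 / c2)"
  shows "(\<Sum>i\<in>UNIV. (lam k \<oslash> \<alpha> k) $ i * model i (x k) (z1 k *\<^sub>R v k)) \<le> \<zeta> * \<kappa> / 2 * \<theta> k"
proof -
  let ?\<psi> = "\<lambda>r. \<Sum>i\<in>UNIV. (lam k \<oslash> \<alpha> k) $ i * model i (x k) r"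
  note m1 = ray_minimal[OF xk k z1_min[OF k]] and vD = prox_minimal(1)[OF xk]
  have \<kappa>: "0 < \<kappa>" using eps alm by (simp add: \<kappa>_def)
  have \<zeta>: "0 < \<zeta>" "\<zeta> \<le> 1" "c2 * \<zeta> \<le> \<kappa> * c3"
    using \<kappa> c12 c34 by (auto simp: \<zeta>_def min_def field_simps)
  have c2: "0 < c2" using c12 by linarith
  note \<theta>0 = \<theta>_nonpos[OF xk]
  have "?\<psi> (v k) \<le> (\<Sum>i\<in>UNIV. (lam k \<oslash> \<alpha> k) $ i * (\<alpha>min * (1 - \<epsilon>) * \<theta> k))"
    by (intro sum_mono mult_left_mono model_v_le xk w_nonneg k)
  also have "\<dots> = (\<Sum>i\<in>UNIV. (lam k \<oslash> \<alpha> k) $ i) * (\<alpha>min * (1 - \<epsilon>) * \<theta> k)"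
    by (simp add: sum_distrib_right)
  also have "\<dots> \<le> 1 / \<alpha>max * (\<alpha>min * (1 - \<epsilon>) * \<theta> k)"
    using w_sum[OF k] \<theta>0 eps alm by (intro mult_right_mono_neg) (auto simp: mult_nonneg_nonpos)
  finally have one: "?\<psi> (v k) \<le> \<kappa> * \<theta> k" by (simp add: \<kappa>_def mult_ac)
  have "?\<psi> (\<zeta> *\<^sub>R v k) \<le> \<zeta> * ?\<psi> (v k)"
    using \<zeta> by (intro sum_model_scale xk vD w_nonneg k) auto
  also have "\<dots> \<le> \<zeta> * (\<kappa> * \<theta> k)" using one \<zeta> by (intro mult_left_mono) auto
  finally have *: "?\<psi> (\<zeta> *\<^sub>R v k) \<le> \<zeta> * (\<kappa> * \<theta> k)" .
  have "q k (v k) * (norm (\<zeta> *\<^sub>R v k))\<^sup>2 \<le> c2 * (norm (\<zeta> *\<^sub>R v k))\<^sup>2"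
    using q_bounds by (intro mult_right_mono) auto
  also have "\<dots> = c2 * \<zeta> * (\<zeta> * (norm (v k))\<^sup>2)"
    by (simp add: power_mult_distrib power2_eq_square)
  also have "\<dots> \<le> \<kappa> * c3 * (\<zeta> * (norm (v k))\<^sup>2)" using \<zeta> by (intro mult_right_mono) auto
  also have "\<dots> = \<zeta> * \<kappa> * (c3 * (norm (v k))\<^sup>2)" by simp
  also have "\<dots> \<le> \<zeta> * \<kappa> * (- \<theta> k)" using \<theta>_le[OF xk] \<zeta> \<kappa> by (intro mult_left_mono) auto
  finally have **: "q k (v k) * (norm (\<zeta> *\<^sub>R v k))\<^sup>2 / 2 \<le> - (\<zeta> * \<kappa> / 2 * \<theta> k)" by simp
  have "0 \<le> q k (v k) * (norm (z1 k *\<^sub>R v k))\<^sup>2 / 2"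
    using q_bounds(1)[of k "v k"] c12 by simp
  then show ?thesis
    using m1(2)[OF model_scale(1)[OF xk vD, of \<zeta>]] \<zeta> * ** by simp
qed

text \<open>The two bounds serve different ends: the one by the squared norm makes the line search accept steps
  bounded away from \<open>0\<close>, the one by \<open>\<theta> k\<close> measures how much each objective then drops.  Minima
  merge the constants of the first iteration with those of the later ones.\<close>

lemma uniform_model_decrease:
  obtains \<beta>1 \<beta>2 where "0 < \<beta>1" "0 < \<beta>2"
    and "\<And>k. x k \<in> D \<Longrightarrow> x k + d k \<in> D"
    and "\<And>k i. x k \<in> D \<Longrightarrow> model i (x k) (d k) \<le> \<beta>1 * \<theta> k"
    and "\<And>k i. x k \<in> D \<Longrightarrow> model i (x k) (d k) \<le> - (\<beta>2 * (norm (d k))\<^sup>2)"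
proof -
  define \<kappa> where "\<kappa> = (1 - \<epsilon>) * \<alpha>min / \<alpha>max"
  define \<zeta> where "\<zeta> = min 1 (\<kappa> * c3 / c2)"
  define a where "a = \<alpha>min * (1 - \<epsilon>)"
  define b where "b = \<alpha>min * (1 - \<delta>) / 2"
  define \<beta>1 where "\<beta>1 = min a (b * (\<zeta> * \<kappa> / 2))"
  define \<beta>2 where "\<beta>2 = min (a * c3) (b * (2 * c1))"
  have ab: "0 < a" "0 < b" using alm eps del by (auto simp: a_def b_def)
  have \<kappa>: "0 < \<kappa>" using eps alm by (simp add: \<kappa>_def)
  then have \<zeta>: "0 < \<zeta>" using c12 c34 by (auto simp: \<zeta>_def)
  have \<beta>: "0 < \<beta>1" "0 < \<beta>2" using ab \<kappa> \<zeta> c12 c34 by (auto simp: \<beta>1_def \<beta>2_def)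
  have "x k + d k \<in> D \<and> model i (x k) (d k) \<le> \<beta>1 * \<theta> k \<and> model i (x k) (d k) \<le> - (\<beta>2 * (norm (d k))\<^sup>2)"
    if xk: "x k \<in> D" for k i
  proof -
    note \<theta>0 = \<theta>_nonpos[OF xk]
    have \<beta>1_le: "c * \<theta> k \<le> \<beta>1 * \<theta> k" if "\<beta>1 \<le> c" for c
      using that \<theta>0 by (rule mult_right_mono_neg)
    have \<beta>2_le: "\<beta>2 * (norm (d k))\<^sup>2 \<le> c * (norm (d k))\<^sup>2" if "\<beta>2 \<le> c" for c
      using that by (intro mult_right_mono) auto
    show ?thesis
    proof (cases "k = 0")
      case True
      then have dk: "d k = v k" by (simp add: d_def)
      have "a * \<theta> k \<le> - (a * c3 * (norm (v k))\<^sup>2)"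
        using mult_left_mono[OF \<theta>_le[OF xk], of a] ab by simp
      then show ?thesis
        using model_v_le[OF xk, of i] \<beta>1_le[of a] \<beta>2_le[of "a * c3"] prox_minimal(1)[OF xk]
        unfolding dk a_def[symmetric] by (simp add: \<beta>1_def \<beta>2_def)
    next
      case False
      then have k: "1 \<le> k" by simp
      let ?\<psi> = "\<lambda>r. \<Sum>i\<in>UNIV. (lam k \<oslash> \<alpha> k) $ i * model i (x k) r"
      let ?p = "z1 k *\<^sub>R v k" and ?r = "z2 k *\<^sub>R ut k"
      note m1 = ray_minimal[OF xk k z1_min[OF k]] and m2 = ray_minimal[OF xk k z2_min[OF k]]
      have dk: "d k = (1 / 2) *\<^sub>R (?p + ?r)" using k by (simp add: d_def dS_def)
      have "4 * (norm (d k))\<^sup>2 = (norm (?p + ?r))\<^sup>2"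
        unfolding dk by (simp add: power_mult_distrib power_divide)
      also have "\<dots> \<le> 2 * (norm ?p)\<^sup>2 + 2 * (norm ?r)\<^sup>2"
        by (rule norm_add_square_le)
      finally have "2 * (norm (d k))\<^sup>2 \<le> (norm ?p)\<^sup>2 + (norm ?r)\<^sup>2" by simp
      then have "c1 * (2 * (norm (d k))\<^sup>2) \<le> c1 * ((norm ?p)\<^sup>2 + (norm ?r)\<^sup>2)"
        using c12 by (intro mult_left_mono) auto
      then have "?\<psi> ?p + ?\<psi> ?r \<le> - (2 * c1 * (norm (d k))\<^sup>2)"
        using m1(3) m2(3) by (simp add: distrib_left)
      from mult_left_mono[OF this, of b] ab
      have 1: "b * (?\<psi> ?p + ?\<psi> ?r) \<le> - (b * (2 * c1) * (norm (d k))\<^sup>2)" by simp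
      have "0 \<le> c1 * (norm ?r)\<^sup>2" using c12 by simp
      then have "?\<psi> ?p + ?\<psi> ?r \<le> \<zeta> * \<kappa> / 2 * \<theta> k"
        using m2(3) subspace_model_le_prox[OF xk k] unfolding \<zeta>_def \<kappa>_def by linarith
      from mult_left_mono[OF this, of b] ab
      have 2: "b * (?\<psi> ?p + ?\<psi> ?r) \<le> b * (\<zeta> * \<kappa> / 2) * \<theta> k" by simp
      have "\<beta>1 \<le> b * (\<zeta> * \<kappa> / 2)" "\<beta>2 \<le> b * (2 * c1)"
        unfolding \<beta>1_def \<beta>2_def by (rule min.cobounded2)+
      note \<beta>1_le[OF this(1)] \<beta>2_le[OF this(2)]
      moreover have "model i (x k) (d k) \<le> b * (?\<psi> ?p + ?\<psi> ?r)"
        unfolding b_def by (rule subspace_model_le(2)[OF xk k])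
      ultimately show ?thesis
        using subspace_model_le(1)[OF xk k] 1 2 by linarith
    qed
  qed
  then show thesis using that \<beta> by blast
qed

section \<open>Line search and decrease of the objectives\<close>

text \<open>Sufficient decrease holds once the quadratic error of the smooth part is at most the fraction
  \<open>1 - \<sigma>\<close> of the model decrease.  The error is bounded above, and the decrease below, by a multiple of the
  squared norm of \<open>d k\<close>, which therefore cancels from the condition on the exponent.\<close>

lemma armijo_of_small_step:
  assumes xk: "x k \<in> D" and dk: "x k + d k \<in> D"
    and desc: "\<And>i. model i (x k) (d k) \<le> - (\<beta> * (norm (d k))\<^sup>2)"
    and L: "\<And>i. L i \<le> Lb" and small: "Lb * \<gamma> ^ j \<le> 2 * (1 - \<sigma>) * \<beta>"
  shows "armijo k j"
proof -
  let ?\<tau> = "\<gamma> ^ j"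
  have \<tau>: "0 < ?\<tau>" "?\<tau> \<le> 1" using gam by (auto simp: power_le_one)
  note tD = model_scale(1)[OF xk dk less_imp_le[OF \<tau>(1)] \<tau>(2)]
  have "f i (x k + ?\<tau> *\<^sub>R d k) + H i (x k + ?\<tau> *\<^sub>R d k) - (f i (x k) + H i (x k))
      \<le> \<sigma> * ?\<tau> * model i (x k) (d k)" for i
  proof -
    have "f i (x k + ?\<tau> *\<^sub>R d k) \<le> f i (x k) + grad i (x k) \<bullet> (?\<tau> *\<^sub>R d k)
        + L i / 2 * (norm (?\<tau> *\<^sub>R d k))\<^sup>2"
      using smooth[of i] unfolding L_smooth_def by (metis add_diff_cancel_left')
    then have "f i (x k + ?\<tau> *\<^sub>R d k) + H i (x k + ?\<tau> *\<^sub>R d k) - (f i (x k) + H i (x k))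
        \<le> model i (x k) (?\<tau> *\<^sub>R d k) + L i / 2 * (norm (?\<tau> *\<^sub>R d k))\<^sup>2"
      by (simp add: model_def)
    moreover have "L i / 2 * (norm (?\<tau> *\<^sub>R d k))\<^sup>2 \<le> Lb / 2 * (norm (?\<tau> *\<^sub>R d k))\<^sup>2"
      using L[of i] by (intro mult_right_mono) auto
    moreover have "Lb / 2 * (norm (?\<tau> *\<^sub>R d k))\<^sup>2 = Lb * ?\<tau> * (?\<tau> / 2 * (norm (d k))\<^sup>2)"
      by (simp add: power_mult_distrib power2_eq_square)
    moreover have "Lb * ?\<tau> * (?\<tau> / 2 * (norm (d k))\<^sup>2)
        \<le> 2 * (1 - \<sigma>) * \<beta> * (?\<tau> / 2 * (norm (d k))\<^sup>2)"
      using small \<tau> by (intro mult_right_mono) auto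
    moreover have "2 * (1 - \<sigma>) * \<beta> * (?\<tau> / 2 * (norm (d k))\<^sup>2)
        = (1 - \<sigma>) * ?\<tau> * (\<beta> * (norm (d k))\<^sup>2)" by simp
    moreover have "(1 - \<sigma>) * ?\<tau> * (\<beta> * (norm (d k))\<^sup>2) \<le> (1 - \<sigma>) * ?\<tau> * (- model i (x k) (d k))"
      using desc[of i] sig \<tau> by (intro mult_left_mono) auto
    moreover have "model i (x k) (?\<tau> *\<^sub>R d k) \<le> ?\<tau> * model i (x k) (d k)"
      using \<tau> by (intro model_scale(2) xk dk) auto
    moreover have "(1 - \<sigma>) * ?\<tau> * (- model i (x k) (d k)) + ?\<tau> * model i (x k) (d k)
        = \<sigma> * ?\<tau> * model i (x k) (d k)" by (simp add: algebra_simps)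
    ultimately show ?thesis by linarith
  qed
  then show ?thesis
    unfolding armijo_def matrix_vector_right_distrib[symmetric]
    by (simp add: composite_eq g_eq tD xk dk model_def)
qed

lemma descent:
  "\<exists>\<beta>>0. \<forall>k. x k \<in> D \<and>
    (\<forall>i. f i (x (Suc k)) + H i (x (Suc k)) \<le> f i (x k) + H i (x k) + \<beta> * \<theta> k)"
proof -
  obtain \<beta>1 \<beta>2 where \<beta>: "0 < \<beta>1" "0 < \<beta>2"
    and dD: "\<And>k. x k \<in> D \<Longrightarrow> x k + d k \<in> D"
    and l1: "\<And>k i. x k \<in> D \<Longrightarrow> model i (x k) (d k) \<le> \<beta>1 * \<theta> k"
    and l2: "\<And>k i. x k \<in> D \<Longrightarrow> model i (x k) (d k) \<le> - (\<beta>2 * (norm (d k))\<^sup>2)"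
    using uniform_model_decrease by blast
  define Lb where "Lb = 1 + (\<Sum>i\<in>UNIV. \<bar>L i\<bar>)"
  have Lpos: "0 < Lb" unfolding Lb_def by (simp add: add_pos_nonneg sum_nonneg)
  have Lb: "L i \<le> Lb" for i
    using member_le_sum[of i UNIV "\<lambda>i. \<bar>L i\<bar>"] by (simp add: Lb_def)
  obtain J where "\<gamma> ^ J < 2 * (1 - \<sigma>) * \<beta>2 / Lb"
    using real_arch_pow_inv[of "2 * (1 - \<sigma>) * \<beta>2 / Lb" \<gamma>] \<beta> Lpos sig gam by auto
  then have J: "Lb * \<gamma> ^ J \<le> 2 * (1 - \<sigma>) * \<beta>2" using Lpos by (simp add: field_simps)
  \<comment> \<open>\<open>J\<close> does not depend on \<open>k\<close>, so the accepted power is never smaller than \<open>\<gamma> ^ J\<close>.\<close>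
  have step: "x (Suc k) \<in> D \<and>
      f i (x (Suc k)) + H i (x (Suc k)) \<le> f i (x k) + H i (x k) + \<sigma> * \<gamma> ^ J * \<beta>1 * \<theta> k"
    if xk: "x k \<in> D" for k i
  proof -
    define j where "j = (LEAST j. armijo k j)"
    have aJ: "armijo k J" by (rule armijo_of_small_step[OF xk dD[OF xk] l2[OF xk] Lb J])
    have aj: "armijo k j" unfolding j_def using aJ by (rule LeastI)
    have "j \<le> J" unfolding j_def using aJ by (rule Least_le)
    then have jJ: "\<gamma> ^ J \<le> \<gamma> ^ j" using gam by (intro power_decreasing) auto
    have xS: "x (Suc k) = x k + \<gamma> ^ j *\<^sub>R d k" by (simp add: x_step t_def j_def)
    have D': "x (Suc k) \<in> D"
      unfolding xS using gam by (intro model_scale(1) xk dD) (auto simp: power_le_one)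
    have "f i (x (Suc k)) + H i (x (Suc k)) \<le> f i (x k) + H i (x k) + \<sigma> * \<gamma> ^ j * model i (x k) (d k)"
      using spec[OF aj[unfolded armijo_def matrix_vector_right_distrib[symmetric] xS[symmetric]], of i]
      by (simp add: composite_eq g_eq D' xk dD model_def)
    moreover have "\<sigma> * \<gamma> ^ j * model i (x k) (d k) \<le> \<sigma> * \<gamma> ^ j * (\<beta>1 * \<theta> k)"
      by (rule mult_left_mono[OF l1[OF xk]]) (use sig gam in simp)
    moreover have "\<sigma> * \<gamma> ^ j * (\<beta>1 * \<theta> k) \<le> \<sigma> * \<gamma> ^ J * (\<beta>1 * \<theta> k)"
    proof (rule mult_right_mono_neg)
      show "\<sigma> * \<gamma> ^ J \<le> \<sigma> * \<gamma> ^ j" by (rule mult_left_mono[OF jJ]) (use sig in simp)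
      show "\<beta>1 * \<theta> k \<le> 0" using \<beta>(1) \<theta>_nonpos[OF xk] by (simp add: mult_le_0_iff)
    qed
    ultimately have "f i (x (Suc k)) + H i (x (Suc k)) \<le>
        f i (x k) + H i (x k) + \<sigma> * \<gamma> ^ J * (\<beta>1 * \<theta> k)" by linarith
    then show ?thesis using D' by (simp add: mult.assoc)
  qed
  have D: "x k \<in> D" for k
  proof (induction k)
    case 0
    show ?case using x_0 by (simp add: D_def)
  next
    case (Suc k)
    then show ?case by (rule step[THEN conjunct1])
  qed
  moreover have "0 < \<sigma> * \<gamma> ^ J * \<beta>1" using sig gam \<beta> by simp
  ultimately show ?thesis using step[THEN conjunct2] by blast
qed

section \<open>Accumulation points\<close>

lemma x_in_D: "x k \<in> D"
  using descent by blast

lemma objective_antimono: "decseq (\<lambda>k. f i (x k) + H i (x k))"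
proof -
  obtain \<beta> where \<beta>: "0 < \<beta>"
    and desc: "\<And>k i. f i (x (Suc k)) + H i (x (Suc k)) \<le> f i (x k) + H i (x k) + \<beta> * \<theta> k"
    using descent by blast
  have "\<beta> * \<theta> k \<le> 0" for k
    using \<beta> \<theta>_nonpos[OF x_in_D] by (simp add: mult_le_0_iff)
  then show ?thesis
    by (intro decseq_SucI) (meson desc order_trans add_le_same_cancel1)
qed

lemma x_in_level_set: "x k \<in> level_set (composite f g A) (x 0)"
  using decseqD[OF objective_antimono, of 0 k]
  by (auto simp: level_set_def composite_eq x_in_D)

lemma accumulation_point_exists: "\<exists>xs. accumulation_point x xs"
  using level_compact[OF x_0] x_in_level_set
  unfolding compact_def accumulation_point_def by blast

context
  fixes r :: "nat \<Rightarrow> nat" and xs :: "real^'n"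
  assumes r: "strict_mono r" and lim: "(\<lambda>n. x (r n)) \<longlonglongrightarrow> xs"
begin

lemma limit_in_D: "xs \<in> D"
proof -
  have "xs \<in> level_set (composite f g A) (x 0)"
    using closed_sequentially[OF compact_imp_closed[OF level_compact[OF x_0]] _ lim] x_in_level_set
    by blast
  then have "composite f g A i xs \<le> ereal (f i (x 0) + H i (x 0))" for i
    by (simp add: level_set_def composite_eq[OF x_in_D])
  then have "composite f g A i xs \<noteq> \<infinity>" for i
    by (metis ereal_infty_less_eq(1) PInfty_neq_ereal(1))
  then show ?thesis by (auto simp: D_iff composite_def)
qed

text \<open>Lower semicontinuity is all that is available here: the iterates may approach the boundary of the
  domain, where \<open>H i\<close> can be discontinuous.\<close>

lemma H_lsc_at_limit:
  assumes "c < H i xs"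
  shows "eventually (\<lambda>n. c < H i (x (r n))) sequentially"
proof -
  have "(\<lambda>n. A *v x (r n)) \<longlonglongrightarrow> A *v xs"
    by (rule isCont_tendsto_compose[OF _ lim])
       (simp add: linear_continuous_at matrix_vector_mul_bounded_linear)
  moreover have "eventually (\<lambda>z. ereal c < g i z) (nhds (A *v xs))"
    using assms by (intro lsc_fun_eventually_greater lsc) (simp add: g_eq limit_in_D)
  ultimately have "eventually (\<lambda>n. ereal c < g i (A *v x (r n))) sequentially"
    by (rule eventually_compose_filterlim[rotated])
  then show ?thesis by (simp add: g_eq x_in_D)
qed

text \<open>The objective values decrease and are bounded below by semicontinuity at the accumulation
  point, so they converge; successive differences dominate \<open>- \<theta> k\<close> up to a constant.\<close>

lemma \<theta>_tendsto_0: "\<theta> \<longlonglongrightarrow> 0"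
proof -
  obtain \<beta> where \<beta>: "0 < \<beta>"
    and desc: "\<And>k i. f i (x (Suc k)) + H i (x (Suc k)) \<le> f i (x k) + H i (x k) + \<beta> * \<theta> k"
    using descent by blast
  \<comment> \<open>The index type is inhabited, and the decrease of any single objective suffices.\<close>
  fix i :: 'm
  let ?F = "\<lambda>k. f i (x k) + H i (x k)"
  have cont: "isCont (f i) xs"
    using C1[of i] by (auto simp: C1_with_gradient_def gderiv_def intro: has_derivative_continuous)
  \<comment> \<open>A crude bound is enough: it allows an error of \<open>1\<close> for each of the two summands.\<close>
  have "f i xs + H i xs - 2 \<le> ?F k" for k
  proof -
    have "eventually (\<lambda>n. f i xs - 1 < f i (x (r n))) sequentially"
      by (rule order_tendstoD(1)[OF isCont_tendsto_compose[OF cont lim]]) simp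
    moreover have "eventually (\<lambda>n. H i xs - 1 < H i (x (r n))) sequentially"
      by (rule H_lsc_at_limit) simp
    moreover have "eventually (\<lambda>n. k \<le> r n) sequentially"
      using filterlim_subseq[OF r] by (simp add: filterlim_at_top)
    ultimately have "eventually (\<lambda>n. f i xs + H i xs - 2 \<le> ?F k) sequentially"
    proof eventually_elim
      case (elim n)
      then show ?case using decseqD[OF objective_antimono, of k "r n" i] by linarith
    qed
    then show ?thesis by simp
  qed
  then obtain l where l: "?F \<longlonglongrightarrow> l"
    using decseq_convergent[OF objective_antimono] by metis
  have "(\<lambda>k. (?F (Suc k) - ?F k) / \<beta>) \<longlonglongrightarrow> (l - l) / \<beta>"
    using \<beta> by (intro tendsto_intros l LIMSEQ_Suc[OF l]) auto
  then have "(\<lambda>k. (?F (Suc k) - ?F k) / \<beta>) \<longlonglongrightarrow> 0" by simp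
  moreover have "\<forall>k. (?F (Suc k) - ?F k) / \<beta> \<le> \<theta> k"
    using desc[of i] \<beta> by (simp add: field_simps)
  moreover have "\<forall>k. \<theta> k \<le> 0" using \<theta>_nonpos[OF x_in_D] by simp
  ultimately show ?thesis
    by (rule tendsto_sandwich[OF always_eventually always_eventually _ tendsto_const, rotated 2])
qed

text \<open>Testing the proximal problem with the point \<open>xs + \<tau> *\<^sub>R e\<close> gains at least a term linear in \<open>\<tau>\<close> and
  loses one quadratic in \<open>\<tau>\<close>.  The linear gain is uniform over the weights, which vary with the
  iteration, because all models are negative at once and the sum of the weights is bounded below.\<close>

lemma no_common_descent:
  assumes "xs + e \<in> D"
  shows "\<exists>i. 0 \<le> model i xs e"
proof (rule ccontr)
  assume "\<not> (\<exists>i. 0 \<le> model i xs e)"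
  then have neg: "model i xs e < 0" for i by (auto simp: not_le)
  define c where "c = Min (range (\<lambda>i. - model i xs e))"
  have c: "0 < c" "model i xs e \<le> - c" for i
  proof -
    show "0 < c" using neg by (simp add: c_def)
    have "c \<le> - model i xs e" unfolding c_def by (rule Min_le) auto
    then show "model i xs e \<le> - c" by simp
  qed
  \<comment> \<open>The summand \<open>1\<close> keeps the divisor in the choice of \<open>\<tau>\<close> positive.\<close>
  define N where "N = (norm e)\<^sup>2 + 1"
  have N: "0 < N" "(norm e)\<^sup>2 \<le> N" by (auto simp: N_def add_nonneg_pos)
  have c4: "0 < c4" and am: "0 < \<alpha>max" using c34 alm by linarith+
  define \<tau> where "\<tau> = min 1 (c / (2 * \<alpha>max * c4 * N))"
  have \<tau>: "0 < \<tau>" "\<tau> \<le> 1" "c4 * \<tau> * N \<le> c / (2 * \<alpha>max)"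
    using c N c4 am by (auto simp: \<tau>_def min_def field_simps)
  define p where "p = xs + \<tau> *\<^sub>R e"
  have pD: "p \<in> D" unfolding p_def using \<tau> by (intro model_scale(1) limit_in_D assms) auto
  have model_p: "model i xs (p - xs) \<le> - (\<tau> * c)" for i
  proof -
    have "model i xs (\<tau> *\<^sub>R e) \<le> \<tau> * model i xs e"
      using \<tau> by (intro model_scale(2) limit_in_D assms) auto
    also have "\<dots> \<le> \<tau> * - c" using c \<tau> by (intro mult_left_mono) auto
    finally show ?thesis by (simp add: p_def)
  qed
  have ev_each: "eventually (\<lambda>n. model i (x (r n)) (p - x (r n)) \<le> - (\<tau> * c / 2)) sequentially" for i
  proof -
    have pos: "0 < \<tau> * c / 4" using \<tau> c by simp
    have "isCont (grad i) xs"
      using C1[of i] by (auto simp: C1_with_gradient_def continuous_on_eq_continuous_at)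
    then have "(\<lambda>n. grad i (x (r n)) \<bullet> (p - x (r n))) \<longlonglongrightarrow> grad i xs \<bullet> (p - xs)"
      by (intro tendsto_intros lim isCont_tendsto_compose[of xs "grad i"])
    then have "eventually (\<lambda>n. grad i (x (r n)) \<bullet> (p - x (r n)) < grad i xs \<bullet> (p - xs) + \<tau> * c / 4) sequentially"
      using pos by (intro order_tendstoD(2)) auto
    moreover have "eventually (\<lambda>n. H i xs - \<tau> * c / 4 < H i (x (r n))) sequentially"
      using pos by (intro H_lsc_at_limit) auto
    ultimately show ?thesis
    proof eventually_elim
      case (elim n)
      then show ?case using model_p[of i] by (simp add: model_def)
    qed
  qed
  have ev_all: "eventually (\<lambda>n. \<forall>i. model i (x (r n)) (p - x (r n)) \<le> - (\<tau> * c / 2)) sequentially"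
    by (rule eventually_all_finite) (rule ev_each)
  have "eventually (\<lambda>n. \<theta> (r n) \<le> - (\<tau> * c / 2) / \<alpha>max + c4 * (norm (p - x (r n)))\<^sup>2 / 2) sequentially"
    using ev_all
  proof eventually_elim
    case (elim n)
    let ?k = "r n"
    let ?w = "\<lambda>i. (lamP ?k \<oslash> \<alpha>P ?k) $ i"
    have "(\<Sum>i\<in>UNIV. ?w i * model i (x ?k) (p - x ?k)) \<le> (\<Sum>i\<in>UNIV. ?w i * - (\<tau> * c / 2))"
      using elim by (intro sum_mono mult_left_mono wP_nonneg) auto
    also have "\<dots> = (\<Sum>i\<in>UNIV. ?w i) * - (\<tau> * c / 2)"
      by (simp only: sum_distrib_right)
    also have "\<dots> \<le> 1 / \<alpha>max * - (\<tau> * c / 2)"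
      using \<tau> c by (intro mult_right_mono_neg wP_sum) auto
    finally have "(\<Sum>i\<in>UNIV. ?w i * model i (x ?k) (p - x ?k)) \<le> - (\<tau> * c / 2) / \<alpha>max" by simp
    moreover have "\<theta> ?k + (mnorm (P ?k) (v ?k))\<^sup>2 / 2 \<le>
        (\<Sum>i\<in>UNIV. ?w i * model i (x ?k) (p - x ?k)) + (mnorm (P ?k) (p - x ?k))\<^sup>2 / 2"
      by (rule prox_minimal(2)[OF x_in_D]) (simp add: pD)
    ultimately show ?case
      using mnorm_bounds(2)[of ?k "p - x ?k"] zero_le_power2[of "mnorm (P ?k) (v ?k)"] by linarith
  qed
  moreover have "(\<lambda>n. - (\<tau> * c / 2) / \<alpha>max + c4 * (norm (p - x (r n)))\<^sup>2 / 2)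
      \<longlonglongrightarrow> - (\<tau> * c / 2) / \<alpha>max + c4 * (norm (p - xs))\<^sup>2 / 2"
    by (intro tendsto_intros lim) auto
  moreover have "(\<lambda>n. \<theta> (r n)) \<longlonglongrightarrow> 0"
    using LIMSEQ_subseq_LIMSEQ[OF \<theta>_tendsto_0 r] by (simp add: o_def)
  ultimately have le: "0 \<le> - (\<tau> * c / 2) / \<alpha>max + c4 * (norm (p - xs))\<^sup>2 / 2"
    by (intro tendsto_le[OF sequentially_bot])
  have "c4 * (norm (p - xs))\<^sup>2 = c4 * \<tau> * (norm e)\<^sup>2 * \<tau>"
    using \<tau> by (simp add: p_def power_mult_distrib power2_eq_square)
  also have "\<dots> \<le> c4 * \<tau> * N * \<tau>" using N c4 \<tau> by (intro mult_right_mono mult_left_mono) auto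
  also have "\<dots> \<le> c / (2 * \<alpha>max) * \<tau>" using \<tau> by (intro mult_right_mono) auto
  finally have "c4 * (norm (p - xs))\<^sup>2 \<le> \<tau> * c / \<alpha>max / 2" by (simp add: mult.commute)
  with le have "\<tau> * c / \<alpha>max \<le> 0" by simp
  then show False using \<tau> c am by (simp add: divide_le_0_iff mult_le_0_iff)
qed

text \<open>If all directional derivatives along \<open>e\<close> were negative, the difference quotients of the convex
  parts would fall below \<open>- (grad i xs \<bullet> e)\<close> at a common step \<open>\<tau>\<close>, and \<open>\<tau> *\<^sub>R e\<close> would be a common
  descent direction of the models.\<close>

lemma limit_pareto_critical: "pareto_critical (composite f g A) xs"
  unfolding pareto_critical_def
proof (intro conjI allI)
  show "\<bar>composite f g A i xs\<bar> \<noteq> \<infinity>" for i by (simp add: composite_eq limit_in_D)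
  fix e :: "real^'n"
  define h where "h i = (\<lambda>z. g i (A *v z))" for i
  define Q where "Q i \<tau> = (h i (xs + \<tau> *\<^sub>R e) - h i xs) / ereal \<tau>" for i \<tau>
  define l where "l i = ereal (grad i xs \<bullet> e) + (INF \<tau>\<in>{0<..}. Q i \<tau>)" for i
  have hc: "convex_fun (h i)" and hn: "h i z \<noteq> -\<infinity>" and hf: "h i xs = ereal (H i xs)" for i z
    using convex_fun_comp_matrix[OF cvx[of i], of A] proper[of i]
    by (auto simp: h_def proper_fun_def g_eq limit_in_D)
  have dd: "has_dir_deriv (composite f g A i) xs e (l i)" for i
  proof -
    have "composite f g A i = (\<lambda>z. ereal (f i z) + h i z)" by (simp add: composite_def h_def fun_eq_iff)
    then show ?thesis
      unfolding l_def Q_def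
      using has_dir_deriv_smooth_plus_convex[OF hc hn, of i xs "f i" "grad i xs" e] C1[of i]
      by (simp add: hf C1_with_gradient_def)
  qed
  have "0 \<le> (MAX i. l i)"
  proof (rule ccontr)
    assume "\<not> 0 \<le> (MAX i. l i)"
    then have neg: "l i < 0" for i by (simp add: not_le)
    have ev: "eventually (\<lambda>\<tau>. Q i \<tau> < ereal (- (grad i xs \<bullet> e))) (at_right 0)" for i
    proof (rule order_tendstoD(2))
      show "(Q i \<longlongrightarrow> (INF \<tau>\<in>{0<..}. Q i \<tau>)) (at_right 0)"
        unfolding Q_def using hf by (intro convex_fun_quotient_tendsto hc hn) simp
      show "(INF \<tau>\<in>{0<..}. Q i \<tau>) < ereal (- (grad i xs \<bullet> e))"
        using neg[of i] unfolding l_def by (cases "INF \<tau>\<in>{0<..}. Q i \<tau>") auto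
    qed
    have "eventually (\<lambda>\<tau>. (\<forall>i. Q i \<tau> < ereal (- (grad i xs \<bullet> e))) \<and> 0 < \<tau>) (at_right 0)"
      using eventually_all_finite[OF ev] eventually_at_right_less by (rule eventually_conj)
    then obtain \<tau> where \<tau>: "0 < \<tau>" "\<And>i. Q i \<tau> < ereal (- (grad i xs \<bullet> e))"
      using eventually_happens'[OF trivial_limit_at_right_real] by blast
    have "h i (xs + \<tau> *\<^sub>R e) \<noteq> \<infinity>" for i
      using \<tau>(2)[of i] \<tau>(1) by (auto simp: Q_def hf)
    then have D: "xs + \<tau> *\<^sub>R e \<in> D" by (simp add: D_iff h_def)
    then have "h i (xs + \<tau> *\<^sub>R e) = ereal (H i (xs + \<tau> *\<^sub>R e))" for i
      by (simp add: h_def g_eq)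
    then have "model i xs (\<tau> *\<^sub>R e) < 0" for i
      using \<tau>(2)[of i] \<tau>(1) by (simp add: Q_def hf model_def field_simps)
    then show False using no_common_descent[OF D] by (meson not_le)
  qed
  then show "\<exists>l. (\<forall>i. has_dir_deriv (composite f g A i) xs e (l i)) \<and> 0 \<le> (MAX i. l i)"
    using dd by blast
qed

end

lemma accumulation_point_pareto_critical:
  assumes "accumulation_point x xs"
  shows "pareto_critical (composite f g A) xs"
proof -
  from assms obtain r where r: "strict_mono r" and lim: "(x \<circ> r) \<longlonglongrightarrow> xs"
    unfolding accumulation_point_def by (elim exE conjE)
  show ?thesis by (rule limit_pareto_critical[OF r lim[unfolded o_def]])
qed

end

theorem theorem5p1:
  fixes A :: "real^'n^'p"
    and f :: "'m::finite \<Rightarrow> real^'n \<Rightarrow> real"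
    and grad :: "'m \<Rightarrow> real^'n \<Rightarrow> real^'n"
    and g :: "'m \<Rightarrow> real^'p \<Rightarrow> ereal"
    and L :: "'m \<Rightarrow> real"
    and \<epsilon> \<delta> c1 c2 c3 c4 \<sigma> \<gamma> \<alpha>min \<alpha>max :: real
    and xm1 :: "real^'n"
    and x :: "nat \<Rightarrow> real^'n"
    and P :: "nat \<Rightarrow> real^'n^'n"
    and lamP :: "nat \<Rightarrow> real^'m"
    and v u :: "nat \<Rightarrow> real^'n"
    and \<eta> :: "nat \<Rightarrow> real"
    and \<alpha> lam :: "nat \<Rightarrow> real^'m"
    and z1 z2 :: "nat \<Rightarrow> real"
  assumes "\<And>i. C1_with_gradient (f i) (grad i)"
    and "\<And>i. proper_fun (g i)" and "\<And>i. convex_fun (g i)" and "\<And>i. lsc_fun (g i)"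
    and "\<And>x0. x0 \<in> composite_dom g A \<Longrightarrow> compact (level_set (composite f g A) x0)"
    and "\<And>i. L_smooth (f i) (grad i) (L i)"
    and "0 \<le> \<epsilon>" "\<epsilon> < 1" "0 \<le> \<delta>" "\<delta> < 1"
    and "0 < c1" "c1 \<le> c2" "0 < c3" "c3 \<le> c4"
    and "0 < \<sigma>" "\<sigma> < 1" "0 < \<gamma>" "\<gamma> < 1"
    and "0 < \<alpha>min" "\<alpha>min \<le> \<alpha>max"
    and "x 0 \<in> composite_dom g A"
    and "sppbb_run A f grad g \<epsilon> \<delta> c1 c2 c3 c4 \<sigma> \<gamma> \<alpha>min \<alpha>max xm1 x P lamP v u \<eta> \<alpha> lam z1 z2"
  shows "(\<exists>xs. accumulation_point x xs) \<and>
    (\<forall>xs. accumulation_point x xs \<longrightarrow> pareto_critical (composite f g A) xs)"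
proof -
  interpret sppbb_convergence A f grad g \<epsilon> \<delta> c1 c2 c3 c4 \<sigma> \<gamma> \<alpha>min \<alpha>max xm1 x P lamP v u \<eta> \<alpha> lam z1 z2 L
    by (rule sppbb_convergence.intro, rule assms(22), rule sppbb_convergence_axioms.intro)
       (fact assms)+
  show ?thesis
    by (intro conjI allI impI accumulation_point_exists accumulation_point_pareto_critical)
qed

end
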